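(* Let $A(z)$ and $B(z)$ be transcendental entire functions satisfying $\lambda(A)<\rho(A)$ and $\mu(A)\neq\mu(B)$. Then every non-trivial solution $f\not\equiv 0$ of the equation $f''+A(z)f'+B(z)f=0$ satisfies $\rho(f)=\infty$.
   Context: All solutions of the equation are entire functions. For an entire function $f$ with maximum modulus $M(r,f)=\max_{|z|=r}|f(z)|$ and Nevanlinna characteristic $T(r,f)$: the order is $\rho(f)=\limsup_{r\to\infty}\frac{\log^+\log^+M(r,f)}{\log r}=\limsup_{r\to\infty}\frac{\log^+T(r,f)}{\log r}$; the lower order is $\mu(f)=\liminf_{r\to\infty}\frac{\log^+\log^+M(r,f)}{\log r}=\liminf_{r\to\infty}\frac{\log^+T(r,f)}{\log r}$; $\lambda(f)$ denotes the exponent of convergence of the zeros of $f$. *)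

theory Defs
  imports "HOL-Complex_Analysis.Complex_Analysis"
begin

definition transcendental_entire :: "(complex \<Rightarrow> complex) \<Rightarrow> bool" where
  "transcendental_entire f \<longleftrightarrow> f holomorphic_on UNIV \<and> \<not> (\<exists>p :: complex poly. f = poly p)"

text \<open>Only used for nonnegative arguments; the value at \<open>0\<close> is \<open>0\<close>, since \<open>ln 0 = 0\<close>.\<close>
definition log_plus :: "real \<Rightarrow> real" where
  "log_plus x = max 0 (ln x)"

text \<open>For \<open>r \<ge> 0\<close> and continuous \<open>f\<close> the supremum is attained, so this is the maximum of
  \<open>norm (f z)\<close> over \<open>norm z = r\<close>.\<close>
definition max_modulus :: "real \<Rightarrow> (complex \<Rightarrow> complex) \<Rightarrow> real" where
  "max_modulus r f = (SUP z\<in>sphere 0 r. norm (f z))"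

definition growth_order :: "(complex \<Rightarrow> complex) \<Rightarrow> ereal" where
  "growth_order f =
     Limsup at_top (\<lambda>r::real. ereal (log_plus (log_plus (max_modulus r f)) / ln r))"

definition lower_growth_order :: "(complex \<Rightarrow> complex) \<Rightarrow> ereal" where
  "lower_growth_order f =
     Liminf at_top (\<lambda>r::real. ereal (log_plus (log_plus (max_modulus r f)) / ln r))"

text \<open>The infimum of the exponents \<open>s > 0\<close> for which the sum of \<open>norm a powr (- s)\<close> over the zeros
  \<open>a \<noteq> 0\<close> of \<open>f\<close>, counted with multiplicity, converges. It is \<open>\<infinity>\<close> if there is no such \<open>s\<close>, and \<open>0\<close>
  if \<open>f\<close> has only finitely many zeros. The value is meaningful only for entire \<open>f\<close> that do
  not vanish identically.\<close>
definition zeros_exponent :: "(complex \<Rightarrow> complex) \<Rightarrow> ereal" where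
  "zeros_exponent f =
     Inf (ereal ` {s. s > 0 \<and>
       (\<lambda>a. of_int (zorder f a) * norm a powr (- s)) summable_on {a. a \<noteq> 0 \<and> f a = 0}})"

end

theory Submission
  imports Defs "HOL-Real_Asymp.Real_Asymp"
begin

text \<open>
  Suppose that a solution \<open>f \<noteq> 0\<close> has finite order. The discs of radius \<open>r\<close> then contain only
  polynomially many zeros of \<open>f\<close> and \<open>f'\<close>, so about every point of modulus \<open>r\<close> there is a circle,
  of radius between \<open>1/2\<close> and \<open>1\<close>, that stays away from all of them (\<open>good_circles\<close>). On it the
  quotients \<open>f'/f\<close> and \<open>f''/f'\<close> are at most \<open>r ^ K\<close>. Dividing the equation by \<open>f\<close>, or by \<open>f'\<close>,
  gives on that circle
    \<open>\<bar>B\<bar> \<le> r ^ K (1 + \<bar>A\<bar>)\<close> and \<open>\<bar>A\<bar> \<le> exp (r ^ K) (1 + \<bar>B\<bar>)\<close>,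
  and the maximum principle carries the bounds to the centre (\<open>ode_pointwise_bounds\<close>). Because the
  circles are centred at the points of interest, no exceptional sets of radii or directions arise.

  The first inequality shows that the lower order of \<open>B\<close> is at most that of \<open>A\<close>; by hypothesis it
  is then strictly smaller. The second inequality shows that the lower order of \<open>A\<close> is finite. This
  rules out infinite order: the zeros of \<open>A\<close> have convergence exponent below the order of \<open>A\<close>, so
  Hadamard's factorization (\<open>Hadamard_factorization\<close>) gives \<open>A = v exp p\<close> with \<open>p\<close> a polynomial of
  some degree \<open>n\<close>, with \<open>v\<close> growing more slowly than \<open>exp (r ^ n)\<close>, and with the order of \<open>A\<close> at
  most \<open>n\<close>. In the \<open>n\<close> sectors where \<open>Re p\<close> tends to \<open>-\<infinity>\<close> the function \<open>A\<close> is bounded by \<open>1\<close>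
  (\<open>small_in_decay_sectors\<close>), and there the first inequality bounds \<open>B\<close> by a power of \<open>r\<close>. The
  sectors left over have opening barely more than \<open>pi / n\<close>, while the lower order of \<open>B\<close> is less
  than the lower order of \<open>A\<close> and hence less than \<open>n\<close>. So the Phragmen-Lindelof principle
  extends the bound to the whole plane (\<open>polynomial_of_sectorial_bounds\<close>), and \<open>B\<close> is a polynomial,
  a contradiction.
\<close>

section \<open>Growth in terms of the maximum modulus\<close>

lemma log_plus_nonneg [simp]: "log_plus x \<ge> 0"
  by (simp add: log_plus_def)

text \<open>
  The two cut-offs at \<open>0\<close> are harmless: the logarithms are compared with \<open>c *
  ln r\<close> and \<open>r powr c\<close>, which are nonnegative.
\<close>
lemma log_log_ratio_le_iff:
  assumes "r > 1" "c \<ge> 0" "M \<ge> 0"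
  shows "log_plus (log_plus M) / ln r \<le> c \<longleftrightarrow> M \<le> exp (r powr c)"
proof -
  have r: "ln r > 0" "r powr c \<ge> 1" "r powr c > 0"
    using assms by (auto simp: ge_one_powr_ge_zero)
  have "log_plus (log_plus M) / ln r \<le> c \<longleftrightarrow> log_plus (log_plus M) \<le> c * ln r"
    using r by (simp add: field_simps)
  also have "\<dots> \<longleftrightarrow> ln (log_plus M) \<le> c * ln r"
    using r assms by (auto simp: log_plus_def)
  also have "\<dots> \<longleftrightarrow> log_plus M \<le> r powr c"
  proof (cases "log_plus M > 0")
    case True
    have "ln (log_plus M) \<le> c * ln r \<longleftrightarrow> ln (log_plus M) \<le> ln (r powr c)"
      using assms by (simp add: ln_powr)
    also have "\<dots> \<longleftrightarrow> log_plus M \<le> r powr c"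
      using True r by (subst ln_le_cancel_iff) auto
    finally show ?thesis .
  next
    case False
    then have "log_plus M = 0" using log_plus_nonneg[of M] by linarith
    then show ?thesis using r assms by auto
  qed
  also have "\<dots> \<longleftrightarrow> ln M \<le> r powr c"
    using r by (auto simp: log_plus_def)
  also have "\<dots> \<longleftrightarrow> M \<le> exp (r powr c)"
  proof (cases "M > 0")
    case True
    then show ?thesis by (metis exp_gt_zero ln_exp ln_le_cancel_iff)
  next
    case False
    then show ?thesis using r assms(3) by auto
  qed
  finally show ?thesis .
qed

lemma norm_le_max_modulus:
  assumes "f holomorphic_on UNIV" "norm z \<le> r"
  shows "norm (f z) \<le> max_modulus r f"
proof -
  have r: "r \<ge> 0" using assms(2) norm_ge_zero[of z] by linarith
  have "continuous_on UNIV f" using assms(1) by (rule holomorphic_on_imp_continuous_on)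
  then have cont: "continuous_on S f" for S by (rule continuous_on_subset) simp
  have "bdd_above ((\<lambda>z. norm (f z)) ` sphere 0 r)"
    by (intro compact_imp_bounded bounded_imp_bdd_above compact_continuous_image continuous_intros cont) auto
  then have sph: "norm (f w) \<le> max_modulus r f" if "w \<in> sphere 0 r" for w
    unfolding max_modulus_def using that by (intro cSUP_upper) auto
  show ?thesis
  proof (rule maximum_modulus_frontier[of f "cball 0 r"])
    show "f holomorphic_on interior (cball 0 r)"
      using assms(1) by (rule holomorphic_on_subset) simp
  qed (use assms sph cont in auto)
qed

lemma max_modulus_nonneg:
  assumes "f holomorphic_on UNIV" "r \<ge> 0"
  shows "max_modulus r f \<ge> 0"
  using norm_le_max_modulus[OF assms(1), of 0 r] assms(2) norm_ge_zero[of "f 0"]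
  by (metis norm_zero order_trans)

lemma growth_ratio_le_iff:
  assumes "f holomorphic_on UNIV" "c \<ge> 0" "r > 1"
  shows "ereal (log_plus (log_plus (max_modulus r f)) / ln r) \<le> ereal c
           \<longleftrightarrow> max_modulus r f \<le> exp (r powr c)"
  using log_log_ratio_le_iff[OF assms(3,2) max_modulus_nonneg[OF assms(1)]] assms(3) by simp

lemma max_modulus_le:
  assumes "r \<ge> 0" "\<And>z. norm z = r \<Longrightarrow> norm (f z) \<le> K"
  shows "max_modulus r f \<le> K"
  unfolding max_modulus_def
proof (rule cSUP_least)
  show "sphere (0::complex) r \<noteq> {}" using assms(1) by simp
qed (use assms in auto)

lemma growth_order_le:
  assumes "f holomorphic_on UNIV" "c \<ge> 0" "eventually (\<lambda>r. max_modulus r f \<le> exp (r powr c)) at_top"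
  shows "growth_order f \<le> ereal c"
  unfolding growth_order_def
proof (rule Limsup_bounded)
  show "\<forall>\<^sub>F r in at_top. ereal (log_plus (log_plus (max_modulus r f)) / ln r) \<le> ereal c"
    using assms(3) eventually_gt_at_top[of 1]
    by eventually_elim (use growth_ratio_le_iff[OF assms(1) assms(2)] in \<open>force simp: not_le not_less\<close>)
qed

lemma lower_growth_order_le:
  assumes "f holomorphic_on UNIV" "c \<ge> 0" "frequently (\<lambda>r. max_modulus r f \<le> exp (r powr c)) at_top"
  shows "lower_growth_order f \<le> ereal c"
proof (rule ccontr)
  assume "\<not> ?thesis"
  then have "\<forall>\<^sub>F r in at_top. ereal c < ereal (log_plus (log_plus (max_modulus r f)) / ln r)"
    unfolding lower_growth_order_def by (intro less_LiminfD) auto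
  then have "\<forall>\<^sub>F r in at_top. \<not> max_modulus r f \<le> exp (r powr c)"
    using eventually_gt_at_top[of 1]
    by eventually_elim (use growth_ratio_le_iff[OF assms(1) assms(2)] in \<open>force simp: not_le not_less\<close>)
  then show False using assms(3) by (simp add: frequently_def)
qed

lemma growth_order_lessD:
  assumes "f holomorphic_on UNIV" "growth_order f < ereal c" "c \<ge> 0"
  shows "eventually (\<lambda>r. max_modulus r f \<le> exp (r powr c)) at_top"
proof -
  have "\<forall>\<^sub>F r in at_top. ereal (log_plus (log_plus (max_modulus r f)) / ln r) < ereal c"
    using assms(2) unfolding growth_order_def by (rule Limsup_lessD)
  then show ?thesis using eventually_gt_at_top[of 1]
    by eventually_elim (use growth_ratio_le_iff[OF assms(1) assms(3)] in \<open>force simp: not_le not_less\<close>)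
qed

lemma lower_growth_order_lessD:
  assumes "f holomorphic_on UNIV" "lower_growth_order f < ereal c" "c \<ge> 0"
  shows "frequently (\<lambda>r. max_modulus r f \<le> exp (r powr c)) at_top"
proof (rule ccontr)
  assume "\<not> ?thesis"
  then have "\<forall>\<^sub>F r in at_top. \<not> max_modulus r f \<le> exp (r powr c)"
    by (simp add: frequently_def)
  then have "\<forall>\<^sub>F r in at_top. ereal c \<le> ereal (log_plus (log_plus (max_modulus r f)) / ln r)"
    using eventually_gt_at_top[of 1]
    by eventually_elim (use growth_ratio_le_iff[OF assms(1) assms(3)] in \<open>force simp: not_le not_less\<close>)
  then have "ereal c \<le> lower_growth_order f"
    unfolding lower_growth_order_def by (rule Liminf_bounded)
  then show False using assms(2) by simp
qed

lemma lower_growth_order_nonneg: "lower_growth_order f \<ge> 0"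
  unfolding lower_growth_order_def
proof (rule Liminf_bounded)
  show "\<forall>\<^sub>F r in at_top. 0 \<le> ereal (log_plus (log_plus (max_modulus r f)) / ln r)"
    using eventually_gt_at_top[of 1] by eventually_elim auto
qed

lemma lower_growth_order_le_growth_order: "lower_growth_order f \<le> growth_order f"
  unfolding lower_growth_order_def growth_order_def by (rule Liminf_le_Limsup) simp

text \<open>
  An integer exponent and discs instead of spheres make the bound easy to combine with others.
\<close>
definition finite_order :: "(complex \<Rightarrow> complex) \<Rightarrow> bool" where
  "finite_order f \<longleftrightarrow>
     (\<exists>k::nat. eventually (\<lambda>r::real. \<forall>z\<in>cball 0 r. norm (f z) \<le> exp (r ^ k)) at_top)"

lemma finite_order_of_growth_order:
  assumes "growth_order f < \<infinity>" "f holomorphic_on UNIV"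
  shows "finite_order f"
proof -
  obtain c where c: "growth_order f < ereal c"
    using assms(1) less_PInf_Ex_of_nat by fastforce
  define k where "k = nat \<lceil>c\<rceil>"
  have k: "growth_order f < ereal (real k)"
    by (rule less_le_trans[OF c]) (simp add: k_def real_nat_ceiling_ge)
  have "\<forall>\<^sub>F r in at_top. max_modulus r f \<le> exp (r powr real k)"
    by (rule growth_order_lessD[OF assms(2) k]) simp
  then have "eventually (\<lambda>r::real. \<forall>z\<in>cball 0 r. norm (f z) \<le> exp (r ^ k)) at_top"
    using eventually_gt_at_top[of 0]
  proof eventually_elim
    case (elim r)
    then show ?case using norm_le_max_modulus[OF assms(2), of _ r]
      by (fastforce simp: powr_realpow)
  qed
  then show ?thesis unfolding finite_order_def by blast
qed

lemma eventually_times_power_le: "\<forall>\<^sub>F r::real in at_top. C * r ^ k \<le> r ^ Suc k"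
  using eventually_ge_at_top[of C] eventually_ge_at_top[of 0]
  by eventually_elim (auto intro!: mult_right_mono)

lemma finite_order_deriv:
  assumes "f holomorphic_on UNIV" "finite_order f"
  shows "finite_order (deriv f)"
proof -
  obtain k where k: "eventually (\<lambda>r::real. \<forall>z\<in>cball 0 r. norm (f z) \<le> exp (r ^ k)) at_top"
    using assms(2) unfolding finite_order_def by blast
  have "eventually (\<lambda>r::real. \<forall>z\<in>cball 0 (r+1). norm (f z) \<le> exp ((r+1) ^ k)) at_top"
    by (rule eventually_compose_filterlim[OF k]) real_asymp
  then have "eventually (\<lambda>r::real. \<forall>z\<in>cball 0 r. norm (deriv f z) \<le> exp (r ^ Suc k)) at_top"
    using eventually_times_power_le[of "2^k" k] eventually_ge_at_top[of 1]
  proof eventually_elim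
    case (elim r)
    have "norm (deriv f z) \<le> exp (r ^ Suc k)" if z: "norm z \<le> r" for z
    proof -
      have "norm ((deriv ^^ 1) f z) \<le> fact 1 * exp ((r+1)^k) / 1 ^ 1"
      proof (rule Cauchy_inequality)
        show "f holomorphic_on ball z 1" using assms(1) by (rule holomorphic_on_subset) simp
        show "continuous_on (cball z 1) f"
          using assms(1) by (meson holomorphic_on_imp_continuous_on holomorphic_on_subset subset_UNIV)
        fix x assume "norm (z - x) = 1"
        then have "norm x \<le> r + 1"
          using z by (smt (verit) norm_minus_commute norm_triangle_sub)
        then show "norm (f x) \<le> exp ((r+1)^k)" using elim(1) by simp
      qed simp
      also have "\<dots> \<le> exp ((2*r)^k)"
        using elim(3) power_mono[of "r + 1" "2 * r" k] by simp
      also have "\<dots> \<le> exp (r ^ Suc k)" using elim(2) by (simp only: power_mult_distrib exp_le_cancel_iff)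
      finally show ?thesis by simp
    qed
    then show ?case by simp
  qed
  then show ?thesis unfolding finite_order_def by blast
qed


section \<open>Dividing out the zeros in a disc\<close>

text \<open>
  The map \<open>w \<mapsto> w / (2 L - w)\<close> sends the half-plane \<open>Re w < L\<close>
  into the unit disc and fixes \<open>0\<close>, so the Schwarz lemma applies to its composition
  with \<open>g\<close>.
\<close>
lemma Borel_Caratheodory:
  assumes hol: "g holomorphic_on ball c R" and "R > 0" "g c = 0"
    and Re_less: "\<And>z. z \<in> ball c R \<Longrightarrow> Re (g z) < L"
    and z: "norm (z - c) \<le> R / 2"
  shows "norm (g z) \<le> 2 * L"
proof -
  have L: "L > 0" using Re_less[of c] assms by simp
  define \<phi> where "\<phi> w = g (c + R * w) / (2 * L - g (c + R * w))" for w :: complex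
  have in_ball: "c + R * w \<in> ball c R" if "norm w < 1" for w :: complex
    using that \<open>R > 0\<close> by (simp add: dist_norm norm_mult)
  have num_less: "norm (g w) < norm (2 * L - g w)" if "w \<in> ball c R" for w
  proof -
    have "(Re (g w))\<^sup>2 < (2 * L - Re (g w))\<^sup>2"
      using Re_less[OF that] L by (simp add: power2_eq_square algebra_simps)
    then have "(norm (g w))\<^sup>2 < (norm (2 * L - g w))\<^sup>2"
      by (simp add: cmod_power2)
    then show ?thesis by (rule power2_less_imp_less) simp
  qed
  have \<phi>_hol: "\<phi> holomorphic_on ball 0 1"
  proof -
    have "(g \<circ> (\<lambda>w. c + R * w)) holomorphic_on ball 0 1"
      by (rule holomorphic_on_compose_gen[OF _ hol]) (auto intro!: holomorphic_intros in_ball)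
    then have "(\<lambda>w. g (c + R * w)) holomorphic_on ball 0 1" by (simp add: o_def)
    moreover have "2 * L - g (c + R * w) \<noteq> 0" if "w \<in> ball 0 1" for w :: complex
      using num_less[OF in_ball[of w]] that by auto
    ultimately show ?thesis unfolding \<phi>_def by (intro holomorphic_intros) auto
  qed
  define w where "w = (z - c) / R"
  have w: "norm w \<le> 1 / 2" "c + R * w = z"
    using z \<open>R > 0\<close> by (auto simp: w_def norm_divide field_simps)
  have "norm (\<phi> w) \<le> norm w"
  proof (rule Schwarz_Lemma(1)[OF \<phi>_hol])
    fix u :: complex assume "norm u < 1"
    then have "norm (g (c + R * u)) < norm (2 * L - g (c + R * u))"
      by (intro num_less in_ball)
    then show "norm (\<phi> u) < 1"
      using norm_ge_zero[of "g (c + R * u)"]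
      by (simp add: \<phi>_def norm_divide divide_less_eq del: norm_ge_zero)
  qed (use w \<open>g c = 0\<close> in \<open>auto simp: \<phi>_def\<close>)
  then have "norm (\<phi> w) \<le> 1 / 2" using w by simp
  moreover have "norm (2 * L - g z) > 0"
  proof -
    have "z \<in> ball c R" using z \<open>R > 0\<close> by (simp add: dist_norm norm_minus_commute)
    from num_less[OF this] show ?thesis by (rule le_less_trans[OF norm_ge_zero])
  qed
  ultimately have "norm (g z) \<le> norm (2 * L - g z) / 2"
    unfolding \<phi>_def w by (simp add: norm_divide field_simps)
  also have "\<dots> \<le> (2 * L + norm (g z)) / 2"
    using norm_triangle_ineq4[of "of_real (2 * L)" "g z"] L by simp
  finally show ?thesis by simp
qed

lemma holomorphic_divide_linear:
  assumes "H holomorphic_on UNIV" "H a = 0"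
  obtains H' where "H' holomorphic_on UNIV" "\<And>z. H z = (z - a) * H' z"
proof
  let ?H' = "\<lambda>z. if z = a then deriv H a else (H z - H a) / (z - a)"
  show "?H' holomorphic_on UNIV" by (rule pole_lemma_open[OF assms(1)]) simp
  show "H z = (z - a) * ?H' z" for z using assms by auto
qed

lemma norm_prod_linear_ge:
  assumes "\<And>a. a \<in> set zs \<Longrightarrow> d \<le> norm (z - a)" "d \<ge> 0"
  shows "d ^ length zs \<le> norm (\<Prod>a\<leftarrow>zs. z - a :: complex)"
  using assms(1)
proof (induction zs)
  case (Cons b zs)
  have "d * d ^ length zs \<le> norm (z - b) * norm (\<Prod>a\<leftarrow>zs. z - a)"
    using Cons assms(2) by (intro mult_mono) auto
  then show ?case by (simp add: norm_mult)
qed auto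

lemma norm_prod_linear_le:
  assumes "\<And>a. a \<in> set zs \<Longrightarrow> norm (z - a) \<le> d"
  shows "norm (\<Prod>a\<leftarrow>zs. z - a :: complex) \<le> d ^ length zs"
  using assms
proof (induction zs)
  case (Cons b zs)
  have "d \<ge> 0" using Cons.prems[of b] norm_ge_zero[of "z - b"] by (simp del: norm_ge_zero)
  have "norm (z - b) * norm (\<Prod>a\<leftarrow>zs. z - a) \<le> d * d ^ length zs"
    using Cons \<open>d \<ge> 0\<close> by (intro mult_mono) auto
  then show ?case by (simp add: norm_mult)
qed auto

lemma prod_linear_log_derivative:
  assumes "\<And>a. a \<in> set zs \<Longrightarrow> d \<le> norm (z - a)" "d > 0"
  shows "\<exists>D. ((\<lambda>z. \<Prod>a\<leftarrow>zs. z - a) has_field_derivative D) (at z) \<and>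
             norm D \<le> length zs / d * norm (\<Prod>a\<leftarrow>zs. z - a :: complex)"
  using assms(1)
proof (induction zs)
  case (Cons b zs)
  let ?P = "\<Prod>a\<leftarrow>zs. z - a"
  from Cons obtain D where D: "((\<lambda>z. \<Prod>a\<leftarrow>zs. z - a) has_field_derivative D) (at z)"
    "norm D \<le> length zs / d * norm ?P" by auto
  have b: "d \<le> norm (z - b)" using Cons.prems by simp
  have "((\<lambda>z. \<Prod>a\<leftarrow>b # zs. z - a) has_field_derivative (?P + (z - b) * D)) (at z)"
    using D(1) by (auto intro!: derivative_eq_intros)
  moreover have "norm (?P + (z - b) * D) \<le> length (b # zs) / d * norm (\<Prod>a\<leftarrow>b # zs. z - a)"
  proof -
    have "norm ?P \<le> 1 / d * (norm (z - b) * norm ?P)"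
      using b assms(2) by (simp add: field_simps mult_right_mono)
    moreover have "norm (z - b) * norm D \<le> norm (z - b) * (length zs / d * norm ?P)"
      using D(2) by (rule mult_left_mono) simp
    moreover have "norm (?P + (z - b) * D) \<le> norm ?P + norm (z - b) * norm D"
      using norm_triangle_ineq[of ?P "(z - b) * D"] by (simp add: norm_mult)
    moreover have "length (b # zs) / d * norm (\<Prod>a\<leftarrow>b # zs. z - a)
        = 1 / d * (norm (z - b) * norm ?P) + norm (z - b) * (length zs / d * norm ?P)"
      unfolding list.map prod_list.Cons norm_mult using assms(2) by (simp add: field_simps)
    ultimately show ?thesis by linarith
  qed
  ultimately show ?case by blast
qed (auto intro!: exI[of _ 0])

text \<open>
  On the sphere of radius \<open>4 R\<close> every factor \<open>z - a\<close> has modulus at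
  least \<open>3 R\<close>, at the centre at most \<open>R\<close>. The ratio \<open>3\<close> per
  factor bounds the number of factors, much as in Jensen's formula.
\<close>
lemma divide_out_zeros_bound:
  assumes H: "H holomorphic_on UNIV" and fact: "\<And>z. G z = (\<Prod>a\<leftarrow>zs. z - a) * H z"
    and zs: "set zs \<subseteq> cball c R" and "R > 0" and M: "\<And>z. norm (z - c) = 4 * R \<Longrightarrow> norm (G z) \<le> M"
  shows "norm (G c) \<le> R ^ length zs * norm (H c)"
    and "norm (z - c) \<le> 4 * R \<Longrightarrow> (3 * R) ^ length zs * norm (H z) \<le> M"
proof -
  have "norm (\<Prod>a\<leftarrow>zs. c - a) \<le> R ^ length zs"
    by (rule norm_prod_linear_le) (use zs in \<open>auto simp: dist_norm\<close>)
  then show "norm (G c) \<le> R ^ length zs * norm (H c)"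
    by (simp add: fact norm_mult mult_right_mono)
  have on_sphere: "norm (H w) \<le> M / (3 * R) ^ length zs" if w: "norm (w - c) = 4 * R" for w
  proof -
    have "3 * R \<le> norm (w - a)" if "a \<in> set zs" for a
    proof -
      have "norm (c - a) \<le> R" using zs that by (auto simp: dist_norm)
      then show ?thesis using w norm_triangle_ineq[of "w - a" "a - c"]
        by (simp add: norm_minus_commute)
    qed
    then have "(3 * R) ^ length zs \<le> norm (\<Prod>a\<leftarrow>zs. w - a)"
      using \<open>R > 0\<close> by (intro norm_prod_linear_ge) auto
    then have "(3 * R) ^ length zs * norm (H w) \<le> norm (G w)"
      by (simp add: fact norm_mult mult_right_mono)
    then show ?thesis using M[OF w] \<open>R > 0\<close> by (simp add: field_simps)
  qed
  assume "norm (z - c) \<le> 4 * R"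
  have "norm (H z) \<le> M / (3 * R) ^ length zs"
  proof (rule maximum_modulus_frontier[of H "cball c (4 * R)"])
    show "continuous_on (closure (cball c (4 * R))) H"
      using H by (meson holomorphic_on_imp_continuous_on holomorphic_on_subset subset_UNIV)
    show "H holomorphic_on interior (cball c (4 * R))"
      using H by (rule holomorphic_on_subset) simp
    show "z \<in> cball c (4 * R)"
      using \<open>norm (z - c) \<le> 4 * R\<close> by (simp add: dist_norm norm_minus_commute)
    show "norm (H w) \<le> M / (3 * R) ^ length zs" if "w \<in> frontier (cball c (4 * R))" for w
      using that by (intro on_sphere) (auto simp: dist_norm norm_minus_commute)
  qed auto
  then show "(3 * R) ^ length zs * norm (H z) \<le> M" using \<open>R > 0\<close> by (simp add: field_simps)
qed

text \<open>
  Each linear factor that is split off costs a factor \<open>3\<close> in the preceding estimate,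
  so a longest list of zeros exists. The cofactor of a longest list has no zeros in the disc.
\<close>
lemma zero_factorization:
  assumes G: "G holomorphic_on UNIV" "G c \<noteq> 0" and "R > 0"
    and M: "\<And>z. norm (z - c) = 4 * R \<Longrightarrow> norm (G z) \<le> M"
  obtains zs H where "H holomorphic_on UNIV" "\<And>z. G z = (\<Prod>a\<leftarrow>zs. z - a) * H z"
    "\<And>z. z \<in> cball c R \<Longrightarrow> H z \<noteq> 0"
    "norm (G c) \<le> R ^ length zs * norm (H c)" "3 ^ length zs * norm (G c) \<le> M"
    "\<And>z. z \<in> cball c R \<Longrightarrow> norm (H z) * norm (G c) \<le> M * norm (H c)"
proof -
  define P where "P n \<longleftrightarrow> (\<exists>zs H. length zs = n \<and> set zs \<subseteq> cball c R \<and> H holomorphic_on UNIV \<and>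
      (\<forall>z. G z = (\<Prod>a\<leftarrow>zs. z - a) * H z))" for n
  have bound: "3 ^ n * norm (G c) \<le> M" if "P n" for n
  proof -
    from that obtain zs H where zs: "length zs = n" "set zs \<subseteq> cball c R" "H holomorphic_on UNIV"
      "\<And>z. G z = (\<Prod>a\<leftarrow>zs. z - a) * H z" unfolding P_def by blast
    note * = divide_out_zeros_bound[OF zs(3,4,2) \<open>R > 0\<close> M]
    have "3 ^ n * norm (G c) \<le> 3 ^ n * (R ^ n * norm (H c))"
      using *(1) zs(1) by (intro mult_left_mono) auto
    also have "\<dots> = (3 * R) ^ n * norm (H c)" by (simp add: power_mult_distrib)
    also have "\<dots> \<le> M" using *(2)[of c] \<open>R > 0\<close> zs(1) by simp
    finally show ?thesis .
  qed
  have "P 0" unfolding P_def using G(1) by (intro exI[of _ "[]"] exI[of _ G]) auto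
  obtain b where b: "M / norm (G c) < 3 ^ b"
    using real_arch_pow[of 3 "M / norm (G c)"] by auto
  have "n \<le> b" if "P n" for n
  proof (rule ccontr)
    assume "\<not> n \<le> b"
    then have "(3::real) ^ b \<le> 3 ^ n" by (intro power_increasing) auto
    then have "M / norm (G c) < 3 ^ n" using b by linarith
    then show False using bound[OF that] G(2) by (simp add: field_simps)
  qed
  then have fin: "finite {n. P n}" by (meson finite_nat_set_iff_bounded_le mem_Collect_eq)
  define N where "N = Max {n. P n}"
  have "P N" "\<not> P (Suc N)"
    using Max_in[OF fin] Max_ge[OF fin, of "Suc N"] \<open>P 0\<close> unfolding N_def by auto
  from \<open>P N\<close> obtain zs H where zs: "length zs = N" "set zs \<subseteq> cball c R" "H holomorphic_on UNIV"
      "\<And>z. G z = (\<Prod>a\<leftarrow>zs. z - a) * H z" unfolding P_def by blast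
  have nz: "H a \<noteq> 0" if a: "a \<in> cball c R" for a
  proof
    assume "H a = 0"
    then obtain H' where "H' holomorphic_on UNIV" "\<And>z. H z = (z - a) * H' z"
      using holomorphic_divide_linear[OF zs(3)] by blast
    then have "P (Suc N)" unfolding P_def using zs a
      by (intro exI[of _ "a # zs"] exI[of _ H']) (auto simp: mult_ac)
    with \<open>\<not> P (Suc N)\<close> show False by blast
  qed
  note * = divide_out_zeros_bound[OF zs(3,4,2) \<open>R > 0\<close> M]
  have quot: "norm (H z) * norm (G c) \<le> M * norm (H c)" if "z \<in> cball c R" for z
  proof -
    have "norm (z - c) \<le> 4 * R" using that \<open>R > 0\<close> by (simp add: dist_norm norm_minus_commute)
    have "norm (H z) * norm (G c) \<le> norm (H z) * (R ^ N * norm (H c))"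
      using *(1) zs(1) by (intro mult_left_mono) auto
    also have "\<dots> \<le> norm (H z) * ((3 * R) ^ N * norm (H c))"
      using \<open>R > 0\<close> by (intro mult_left_mono mult_right_mono power_mono) auto
    also have "\<dots> = (3 * R) ^ N * norm (H z) * norm (H c)" by simp
    also have "\<dots> \<le> M * norm (H c)"
      using *(2)[of z] \<open>norm (z - c) \<le> 4 * R\<close> zs(1) by (intro mult_right_mono) auto
    finally show ?thesis .
  qed
  show ?thesis
    using that[of H zs] zs nz *(1) bound[OF \<open>P N\<close>] quot by auto
qed

text \<open>
  Write \<open>G\<close> as a product of linear factors times \<open>exp h\<close>. The upper
  bound on \<open>G\<close> bounds \<open>Re h\<close> from above, hence \<open>h - h c\<close>
  and its derivative by the Borel-Caratheodory theorem; at distance \<open>\<delta>\<close> from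
  the zeros each linear factor contributes at most \<open>1 / \<delta>\<close> to the logarithmic
  derivative and at least \<open>\<delta>\<close> to the modulus.
\<close>
lemma bounds_away_from_zeros:
  assumes G: "G holomorphic_on UNIV" "G c \<noteq> 0" and R: "R \<ge> 1"
    and M: "\<And>z. norm (z - c) = 4 * R \<Longrightarrow> norm (G z) \<le> M" and L: "M < exp L * norm (G c)"
  obtains S N where "finite S" "card S \<le> N" "real N \<le> L"
    "\<And>z \<delta>. \<delta> > 0 \<Longrightarrow> norm (z - c) \<le> R / 4 \<Longrightarrow> (\<And>a. a \<in> S \<Longrightarrow> \<delta> \<le> norm (z - a)) \<Longrightarrow>
       norm (deriv G z) \<le> (real N / \<delta> + 8 * L / R) * norm (G z) \<and>
       (\<delta> / R) ^ N * exp (- 2 * L) * norm (G c) \<le> norm (G z)"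
proof -
  have "R > 0" using R by simp
  obtain zs H where H: "H holomorphic_on UNIV" "\<And>z. G z = (\<Prod>a\<leftarrow>zs. z - a) * H z"
    "\<And>z. z \<in> cball c R \<Longrightarrow> H z \<noteq> 0"
    "norm (G c) \<le> R ^ length zs * norm (H c)" "3 ^ length zs * norm (G c) \<le> M"
    "\<And>z. z \<in> cball c R \<Longrightarrow> norm (H z) * norm (G c) \<le> M * norm (H c)"
    by (rule zero_factorization[where G = G and c = c and R = R and M = M]) (use G \<open>R > 0\<close> M in auto)
  define N where "N = length zs"
  have N: "real N \<le> L"
  proof -
    have "exp (real N) = exp 1 ^ N" by (simp flip: exp_of_nat_mult)
    also have "\<dots> \<le> 3 ^ N" using exp_le by (intro power_mono) auto
    also have "\<dots> < exp L"
    proof -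
      have "3 ^ N * norm (G c) < exp L * norm (G c)" using H(5) L N_def by simp
      then show ?thesis using G(2) by simp
    qed
    finally show ?thesis by simp
  qed
  obtain h where h: "h holomorphic_on ball c R" "\<And>z. z \<in> ball c R \<Longrightarrow> exp (h z) = H z"
    by (rule holomorphic_logarithm_exists[of "ball c R" H c])
       (use H \<open>R > 0\<close> in \<open>auto intro: holomorphic_on_subset\<close>)
  have "H c \<noteq> 0" using H(3)[of c] \<open>R > 0\<close> by simp
  define g where "g z = h z - h c" for z
  have g: "g holomorphic_on ball c R" unfolding g_def by (intro holomorphic_intros h)
  have Hg: "H z = H c * exp (g z)" if "z \<in> ball c R" for z
    using h(2)[of c] h(2)[OF that] \<open>R > 0\<close> \<open>H c \<noteq> 0\<close> by (simp add: g_def exp_diff)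
  have Re_g: "Re (g z) < L" if "z \<in> ball c R" for z
  proof -
    have "norm (H c) * exp (Re (g z)) * norm (G c) \<le> M * norm (H c)"
      using H(6)[of z] that by (simp add: Hg norm_mult)
    also have "\<dots> < exp L * norm (G c) * norm (H c)"
      using L \<open>H c \<noteq> 0\<close> by (intro mult_strict_right_mono) auto
    finally have "exp (Re (g z)) * (norm (H c) * norm (G c)) < exp L * (norm (H c) * norm (G c))"
      by (simp add: mult_ac)
    then show ?thesis using \<open>H c \<noteq> 0\<close> G(2)
      by (subst (asm) mult_less_cancel_right_pos) auto
  qed
  have g_bound: "norm (g z) \<le> 2 * L" if "norm (z - c) \<le> R / 2" for z
    by (rule Borel_Caratheodory[OF g \<open>R > 0\<close> _ Re_g that]) (auto simp: g_def)
  have g_deriv: "norm (deriv g z) \<le> 8 * L / R" if "norm (z - c) \<le> R / 4" for z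
  proof -
    have sub: "cball z (R / 4) \<subseteq> cball c (R / 2)"
      using that by (simp add: cball_subset_cball_iff dist_norm)
    have "norm ((deriv ^^ 1) g z) \<le> fact 1 * (2 * L) / (R / 4) ^ 1"
    proof (rule Cauchy_inequality)
      have sub': "cball z (R / 4) \<subseteq> ball c R" using sub \<open>R > 0\<close> by (force simp: subset_iff)
      then show "continuous_on (cball z (R / 4)) g"
        using g by (meson holomorphic_on_imp_continuous_on holomorphic_on_subset)
      show "g holomorphic_on ball z (R / 4)"
        using g sub' by (meson ball_subset_cball holomorphic_on_subset order_trans)
      fix x assume "norm (z - x) = R / 4"
      then have "x \<in> cball c (R / 2)" using sub by (auto simp: dist_norm subset_iff)
      then show "norm (g x) \<le> 2 * L" by (intro g_bound) (simp add: dist_norm norm_minus_commute)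
    qed (use \<open>R > 0\<close> in auto)
    then show ?thesis by simp
  qed
  show ?thesis
  proof (rule that[of "set zs" N])
    show "card (set zs) \<le> N" by (simp add: N_def card_length)
    fix z \<delta> assume \<delta>: "\<delta> > 0" and z: "norm (z - c) \<le> R / 4"
      and away: "\<And>a. a \<in> set zs \<Longrightarrow> \<delta> \<le> norm (z - a)"
    let ?P = "\<lambda>z. \<Prod>a\<leftarrow>zs. z - a"
    have zb: "z \<in> ball c R" using z \<open>R > 0\<close> by (simp add: dist_norm norm_minus_commute)
    obtain D where D: "(?P has_field_derivative D) (at z)" "norm D \<le> N / \<delta> * norm (?P z)"
      using prod_linear_log_derivative[OF away \<delta>] N_def by auto
    have "(g has_field_derivative deriv g z) (at z)"
      using g zb by (intro holomorphic_derivI) auto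
    then have "((\<lambda>z. H c * exp (g z)) has_field_derivative H z * deriv g z) (at z)"
      using Hg[OF zb] by (auto intro!: derivative_eq_intros)
    then have "(H has_field_derivative H z * deriv g z) (at z)"
      by (rule DERIV_cong_ev[THEN iffD1, rotated 3])
         (use zb Hg in \<open>auto intro!: eventually_mono[OF eventually_nhds_in_open[OF _ zb]]\<close>)
    then have "((\<lambda>z. ?P z * H z) has_field_derivative (D * H z + H z * deriv g z * ?P z)) (at z)"
      using D(1) by (auto intro!: derivative_eq_intros)
    then have "deriv G z = D * H z + H z * deriv g z * ?P z"
      using H(2) by (metis (no_types, lifting) DERIV_imp_deriv ext)
    then have "norm (deriv G z) \<le> norm (D * H z) + norm (H z * deriv g z * ?P z)"
      by (simp only: norm_triangle_ineq)
    also have "\<dots> \<le> N / \<delta> * norm (?P z) * norm (H z) + norm (H z) * (8 * L / R) * norm (?P z)"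
      unfolding norm_mult
      by (intro add_mono mult_right_mono mult_left_mono D g_deriv z) auto
    also have "\<dots> = (N / \<delta> + 8 * L / R) * norm (G z)"
      by (simp add: H(2) norm_mult algebra_simps)
    finally have *: "norm (deriv G z) \<le> (N / \<delta> + 8 * L / R) * norm (G z)" .
    have "exp (- 2 * L) \<le> exp (Re (g z))"
      using g_bound[of z] z abs_Re_le_cmod[of "g z"] \<open>R > 0\<close> by simp
    then have "\<delta> ^ N * (norm (G c) / R ^ N * exp (- 2 * L)) \<le> norm (?P z) * (norm (H c) * exp (Re (g z)))"
      using H(4) \<open>R > 0\<close> norm_prod_linear_ge[of zs \<delta> z] away \<delta>
      by (intro mult_mono) (auto simp: N_def field_simps)
    also have "\<dots> = norm (G z)" by (simp add: H(2) Hg[OF zb] norm_mult)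
    finally have "(\<delta> / R) ^ N * exp (- 2 * L) * norm (G c) \<le> norm (G z)"
      by (simp add: power_divide mult_ac)
    with * show "norm (deriv G z) \<le> (N / \<delta> + 8 * L / R) * norm (G z) \<and>
       (\<delta> / R) ^ N * exp (- 2 * L) * norm (G c) \<le> norm (G z)" by blast
  qed (use N in auto)
qed


section \<open>Circles on which a function of finite order is under control\<close>

text \<open>
  Among \<open>N + 1\<close> equally spaced radii in \<open>[1/2, 1]\<close>, each point of
  \<open>S\<close> can be close to at most one of the circles.
\<close>
lemma circle_avoiding_finite_set:
  fixes S :: "complex set"
  assumes "finite S" "card S \<le> N"
  obtains s where "s \<in> {1/2..1}" "\<And>z a. norm (z - z0) = s \<Longrightarrow> a \<in> S \<Longrightarrow> 1 / (4 * (real N + 1)) \<le> norm (z - a)"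
proof -
  define \<delta> where "\<delta> = 1 / (4 * (real N + 1))"
  have \<delta>: "\<delta> > 0" "4 * \<delta> * (real N + 1) = 1" by (auto simp: \<delta>_def field_simps)
  \<comment> \<open>consecutive radii differ by \<open>2 \<delta>\<close>, so two of them cannot be within \<open>\<delta>\<close> of one point\<close>
  define t where "t j = 1 / 2 + 2 * \<delta> * real j" for j :: nat
  have t: "t j \<in> {1/2..1}" if "j \<le> N" for j
  proof -
    have "2 * \<delta> * real j \<le> 2 * \<delta> * (real N + 1)" using that \<delta> by (intro mult_left_mono) auto
    moreover have "2 * \<delta> * (real N + 1) = 1 / 2" using \<delta>(2) by simp
    ultimately show ?thesis using \<delta>(1) by (simp add: t_def)
  qed
  have "\<exists>j\<le>N. \<forall>a\<in>S. \<delta> \<le> \<bar>norm (a - z0) - t j\<bar>"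
  proof (rule ccontr)
    assume "\<not> ?thesis"
    then have "\<forall>j\<in>{..N}. \<exists>a\<in>S. \<bar>norm (a - z0) - t j\<bar> < \<delta>" by (meson atMost_iff not_le)
    then obtain a where a: "\<And>j. j \<le> N \<Longrightarrow> a j \<in> S \<and> \<bar>norm (a j - z0) - t j\<bar> < \<delta>"
      by (metis atMost_iff)
    have "inj_on a {..N}"
    proof (rule inj_onI)
      fix i j assume ij: "i \<in> {..N}" "j \<in> {..N}" "a i = a j"
      have "\<bar>t i - t j\<bar> < 2 * \<delta>" using a[of i] a[of j] ij by auto
      then have "2 * \<delta> * \<bar>real i - real j\<bar> < 2 * \<delta> * 1"
        using \<delta> by (simp add: t_def abs_mult flip: right_diff_distrib)
      then have "\<bar>real i - real j\<bar> < 1" using \<delta> by (subst (asm) mult_less_cancel_left_pos) auto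
      then show "i = j" by linarith
    qed
    then have "card (a ` {..N}) = Suc N" by (simp add: card_image)
    moreover have "card (a ` {..N}) \<le> card S" using a assms by (intro card_mono) auto
    ultimately show False using assms by simp
  qed
  then obtain j where j: "j \<le> N" "\<And>a. a \<in> S \<Longrightarrow> \<delta> \<le> \<bar>norm (a - z0) - t j\<bar>" by blast
  show ?thesis
  proof (rule that[OF t[OF j(1)]])
    fix z a assume "norm (z - z0) = t j" "a \<in> S"
    then show "1 / (4 * (real N + 1)) \<le> norm (z - a)"
      using j(2)[of a] norm_triangle_ineq3[of "a - z0" "z - z0"]
      by (simp add: \<delta>_def norm_minus_commute)
  qed
qed

text \<open>
  The estimate \<open>bounds_away_from_zeros\<close> in a disc of radius \<open>8 r\<close> about
  a point \<open>c\<close> that is not a zero. The number \<open>N\<close> counts zeros with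
  multiplicity and therefore appears as the exponent of \<open>\<delta>\<close>.
\<close>
lemma finite_order_bounds_away_from_zeros:
  assumes G: "G holomorphic_on UNIV" "G c \<noteq> 0" "finite_order G"
  shows "\<exists>K. \<forall>\<^sub>F r in at_top. \<exists>S N. finite S \<and> card S \<le> N \<and> real N \<le> r ^ K \<and>
    (\<forall>\<delta> z. 0 < \<delta> \<longrightarrow> \<delta> \<le> 1 \<longrightarrow> norm z \<le> r + 1 \<longrightarrow> (\<forall>a\<in>S. \<delta> \<le> norm (z - a)) \<longrightarrow>
       norm (deriv G z) \<le> r ^ K / \<delta> * norm (G z) \<and> \<delta> ^ N * exp (- (r ^ K)) \<le> norm (G z))"
proof -
  obtain k where k: "\<forall>\<^sub>F r::real in at_top. \<forall>z\<in>cball 0 r. norm (G z) \<le> exp (r ^ k)"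
    using G(3) unfolding finite_order_def by blast
  have k': "\<forall>\<^sub>F r::real in at_top. \<forall>z\<in>cball 0 (33 * r). norm (G z) \<le> exp ((33 * r) ^ k)"
    by (rule eventually_compose_filterlim[OF k]) real_asymp
  define C where "C = \<bar>ln (norm (G c))\<bar> + 1"
  have "\<forall>\<^sub>F r in at_top. \<exists>S N. finite S \<and> card S \<le> N \<and> real N \<le> r ^ (k + 3) \<and>
    (\<forall>\<delta> z. 0 < \<delta> \<longrightarrow> \<delta> \<le> 1 \<longrightarrow> norm z \<le> r + 1 \<longrightarrow> (\<forall>a\<in>S. \<delta> \<le> norm (z - a)) \<longrightarrow>
       norm (deriv G z) \<le> r ^ (k + 3) / \<delta> * norm (G z) \<and> \<delta> ^ N * exp (- (r ^ (k + 3))) \<le> norm (G z))"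
    using k' eventually_ge_at_top[of "33 ^ k + C"] eventually_ge_at_top[of 11]
      eventually_ge_at_top[of "1 + norm c"]
  proof eventually_elim
    case (elim r)
    \<comment> \<open>the sphere of radius \<open>4 R = 32 r\<close> about \<open>c\<close> lies in the disc of radius \<open>33 r\<close> about \<open>0\<close>\<close>
    define L where "L = (33 * r) ^ k + C"
    define R where "R = 8 * r"
    have r: "r \<ge> 11" by fact
    have C: "C \<ge> 1" by (simp add: C_def)
    have "L \<ge> 1" using r C by (simp add: L_def add_increasing)
    have "L \<le> 33 ^ k * r ^ k + C * r ^ k"
      using r C mult_left_mono[of 1 "r ^ k" C] by (simp add: L_def power_mult_distrib one_le_power)
    also have "\<dots> = (33 ^ k + C) * r ^ k" by (simp add: algebra_simps)
    also have "\<dots> \<le> r * r ^ k" using elim(2) r by (intro mult_right_mono) auto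
    finally have L: "L \<le> r ^ (k + 1)" by simp
    have rL: "r\<^sup>2 * L \<le> r ^ (k + 3)"
      using mult_left_mono[OF L, of "r\<^sup>2"] by (simp add: power2_eq_square power3_eq_cube power_add mult_ac)
    have "11 * r \<le> r\<^sup>2" "r \<le> r\<^sup>2" using r by (simp_all add: power2_eq_square)
    have coef: "a * L \<le> r ^ (k + 3)" if "a \<le> 11 * r" for a
      using mult_right_mono[of a "r\<^sup>2" L] that \<open>11 * r \<le> r\<^sup>2\<close> \<open>L \<ge> 1\<close> rL by linarith
    have M: "norm (G z) \<le> exp ((33 * r) ^ k)" if "norm (z - c) = 4 * R" for z
    proof -
      have "norm z \<le> 33 * r" using that elim(4) norm_triangle_ineq[of "z - c" c] by (simp add: R_def)
      then show ?thesis using elim(1) by simp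
    qed
    have Gc: "exp (- L) \<le> norm (G c)"
    proof -
      have "- L \<le> ln (norm (G c))"
      proof -
        have "(33 * r) ^ k \<ge> 0" using r by simp
        then show ?thesis unfolding L_def C_def by linarith
      qed
      then have "exp (- L) \<le> exp (ln (norm (G c)))" by (rule exp_le_cancel_iff[THEN iffD2])
      then show ?thesis using G(2) by simp
    qed
    have big: "exp ((33 * r) ^ k) < exp L * norm (G c)"
    proof -
      have "exp ((33 * r) ^ k) < exp (L + ln (norm (G c)))" by (simp add: L_def C_def)
      then show ?thesis using G(2) by (simp add: exp_add)
    qed
    have "R \<ge> 1" using r by (simp add: R_def)
    obtain S N where SN: "finite S" "card S \<le> N" "real N \<le> L"
      "\<And>z \<delta>. \<delta> > 0 \<Longrightarrow> norm (z - c) \<le> R / 4 \<Longrightarrow> (\<And>a. a \<in> S \<Longrightarrow> \<delta> \<le> norm (z - a)) \<Longrightarrow>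
       norm (deriv G z) \<le> (real N / \<delta> + 8 * L / R) * norm (G z) \<and>
       (\<delta> / R) ^ N * exp (- 2 * L) * norm (G c) \<le> norm (G z)"
      using bounds_away_from_zeros[OF G(1,2) \<open>R \<ge> 1\<close> M big] by metis
    show ?case
    proof (intro exI conjI allI impI)
      show "real N \<le> r ^ (k + 3)" using SN(3) coef[of 1] r by simp
      fix \<delta> z assume \<delta>: "0 < \<delta>" "\<delta> \<le> 1" and z: "norm z \<le> r + 1" "\<forall>a\<in>S. \<delta> \<le> norm (z - a)"
      have "norm (z - c) \<le> R / 4"
        using z(1) elim(4) norm_triangle_ineq4[of z c] by (simp add: R_def)
      from SN(4)[OF \<delta>(1) this] z(2)
      have b: "norm (deriv G z) \<le> (real N / \<delta> + 8 * L / R) * norm (G z)"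
        "(\<delta> / R) ^ N * exp (- 2 * L) * norm (G c) \<le> norm (G z)" by auto
      have "real N / \<delta> + 8 * L / R \<le> L / \<delta> + 8 * L / \<delta>"
        using SN(3) \<delta> \<open>R \<ge> 1\<close> \<open>L \<ge> 1\<close> by (intro add_mono divide_right_mono divide_left_mono) auto
      also have "\<dots> = 9 * L / \<delta>" by (simp add: field_simps)
      also have "\<dots> \<le> r ^ (k + 3) / \<delta>" using coef[of 9] r \<delta> by (intro divide_right_mono) auto
      finally show "norm (deriv G z) \<le> r ^ (k + 3) / \<delta> * norm (G z)"
        using b(1) by (meson mult_right_mono norm_ge_zero order_trans)
      have "R ^ N \<le> exp (R * L)"
      proof -
        have "R ^ N \<le> exp R ^ N" using \<open>R \<ge> 1\<close> exp_ge_add_one_self[of R]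
          by (intro power_mono) linarith+
        also have "\<dots> = exp (R * real N)" by (metis exp_of_nat_mult mult.commute)
        also have "\<dots> \<le> exp (R * L)" using SN(3) \<open>R \<ge> 1\<close> by simp
        finally show ?thesis .
      qed
      then have RN: "exp (- (R * L)) \<le> 1 / R ^ N"
        using \<open>R \<ge> 1\<close> by (simp add: exp_minus field_simps)
      have "(R + 3) * L \<le> r ^ (k + 3)" using r by (intro coef) (simp add: R_def)
      then have "\<delta> ^ N * exp (- (r ^ (k + 3))) \<le> \<delta> ^ N * exp (- ((R + 3) * L))"
        using \<delta> by (intro mult_left_mono) auto
      also have "\<dots> = \<delta> ^ N * (exp (- (R * L)) * exp (- 2 * L) * exp (- L))"
        by (simp add: algebra_simps flip: exp_add)
      also have "\<dots> \<le> \<delta> ^ N * (1 / R ^ N * exp (- 2 * L) * norm (G c))"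
        using RN Gc \<delta> \<open>R \<ge> 1\<close> by (intro mult_left_mono mult_mono) auto
      also have "\<dots> = (\<delta> / R) ^ N * exp (- 2 * L) * norm (G c)" by (simp add: power_divide)
      finally show "\<delta> ^ N * exp (- (r ^ (k + 3))) \<le> norm (G z)" using b(2) by simp
    qed (use SN in auto)
  qed
  then show ?thesis by blast
qed

text \<open>
  The two functions are treated together because the equation needs one circle that suits both
  \<open>f\<close> and its derivative.
\<close>
lemma good_circles:
  assumes "\<And>G. G \<in> {G1, G2} \<Longrightarrow> G holomorphic_on UNIV \<and> (\<exists>c. G c \<noteq> 0) \<and> finite_order G"
  shows "\<exists>K. \<forall>\<^sub>F r in at_top. \<forall>z0. norm z0 = r \<longrightarrow> (\<exists>s\<in>{1/2..1}. \<forall>z. norm (z - z0) = s \<longrightarrow>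
     (\<forall>G\<in>{G1, G2}. exp (- (r ^ K)) \<le> norm (G z) \<and> norm (deriv G z) \<le> r ^ K * norm (G z)))"
proof -
  define bd where "bd G K r S N \<longleftrightarrow> finite S \<and> card S \<le> N \<and> real N \<le> r ^ K \<and>
    (\<forall>\<delta> z. 0 < \<delta> \<longrightarrow> \<delta> \<le> 1 \<longrightarrow> norm z \<le> r + 1 \<longrightarrow> (\<forall>a\<in>S. \<delta> \<le> norm (z - a)) \<longrightarrow>
       norm (deriv G z) \<le> r ^ K / \<delta> * norm (G z) \<and> \<delta> ^ N * exp (- (r ^ K)) \<le> norm (G z))"
    for G :: "complex \<Rightarrow> complex" and K r S N
  have ex: "\<exists>K. \<forall>\<^sub>F r in at_top. \<exists>S N. bd G K r S N" if "G \<in> {G1, G2}" for G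
    using finite_order_bounds_away_from_zeros[of G] assms[OF that] unfolding bd_def by blast
  from ex[of G1] ex[of G2] obtain K1 K2 where K12:
    "\<forall>\<^sub>F r in at_top. \<exists>S N. bd G1 K1 r S N" "\<forall>\<^sub>F r in at_top. \<exists>S N. bd G2 K2 r S N"
    by auto
  define K where "K = max K1 K2"
  have "\<forall>\<^sub>F r in at_top. \<forall>z0. norm z0 = r \<longrightarrow> (\<exists>s\<in>{1/2..1}. \<forall>z. norm (z - z0) = s \<longrightarrow>
     (\<forall>G\<in>{G1, G2}. exp (- (r ^ (2*K+2))) \<le> norm (G z) \<and> norm (deriv G z) \<le> r ^ (2*K+2) * norm (G z)))"
    using K12 eventually_ge_at_top[of 12]
  proof eventually_elim
    case (elim r)
    from elim obtain S1 N1 S2 N2 where SN: "bd G1 K1 r S1 N1" "bd G2 K2 r S2 N2" by blast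
    have rK: "r ^ K1 \<le> r ^ K" "r ^ K2 \<le> r ^ K" "1 \<le> r ^ K"
      using elim(3) by (auto simp: K_def intro!: power_increasing one_le_power)
    define N where "N = N1 + N2"
    have N: "finite (S1 \<union> S2)" "card (S1 \<union> S2) \<le> N" "real N \<le> 2 * r ^ K"
      using SN rK card_Un_le[of S1 S2] by (auto simp: bd_def N_def)
    define \<delta> where "\<delta> = 1 / (4 * (real N + 1))"
    have \<delta>: "0 < \<delta>" "\<delta> \<le> 1" by (auto simp: \<delta>_def field_simps)
    have "1 / \<delta> = 4 * (real N + 1)" by (simp add: \<delta>_def)
    also have "\<dots> \<le> 12 * r ^ K" using N(3) rK(3) by argo
    also have "\<dots> \<le> r ^ (K + 1)" using elim(3) rK by simp
    finally have \<delta>_inv: "1 / \<delta> \<le> r ^ (K + 1)" .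
    have e1: "r ^ (2 * K + 1) = r ^ K * r ^ (K + 1)"
      unfolding power_add[symmetric] by (simp add: mult_2)
    have e2: "r ^ (2 * K + 2) = r * r ^ (2 * K + 1)" by simp
    have e3: "r ^ K \<le> r ^ (2 * K + 1)"
      using elim(3) by (intro power_increasing) auto
    with rK(3) have e3': "0 \<le> r ^ (2 * K + 1)" by linarith
    have e4: "2 * r ^ (2 * K + 1) \<le> r ^ (2 * K + 2)"
      unfolding e2 using elim(3) e3' by (intro mult_right_mono) auto
    show ?case
    proof (intro allI impI)
      fix z0 :: complex assume z0: "norm z0 = r"
      obtain s where s: "s \<in> {1/2..1}"
        "\<And>z a. norm (z - z0) = s \<Longrightarrow> a \<in> S1 \<union> S2 \<Longrightarrow> \<delta> \<le> norm (z - a)"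
        unfolding \<delta>_def using circle_avoiding_finite_set[OF N(1,2), of z0] by metis
      have concl: "exp (- (r ^ (2*K+2))) \<le> norm (G z) \<and> norm (deriv G z) \<le> r ^ (2*K+2) * norm (G z)"
        if z: "norm (z - z0) = s" and G: "bd G K' r S' N'" "r ^ K' \<le> r ^ K" "S' \<subseteq> S1 \<union> S2"
        for z G K' S' N'
      proof -
        have "norm z \<le> r + 1" using z s(1) z0 norm_triangle_ineq[of "z - z0" z0] by simp
        then have b: "norm (deriv G z) \<le> r ^ K' / \<delta> * norm (G z)" "real N' \<le> r ^ K'"
          "\<delta> ^ N' * exp (- (r ^ K')) \<le> norm (G z)"
          using G(1,3) s(2)[OF z] \<delta> unfolding bd_def by blast+
        have "r ^ K' * (1 / \<delta>) \<le> r ^ K * r ^ (K + 1)"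
          using G(2) \<delta>_inv \<delta> rK by (intro mult_mono) auto
        then have "r ^ K' * (1 / \<delta>) \<le> r ^ (2 * K + 2)" using e1 e3' e4 by linarith
        then have "r ^ K' / \<delta> \<le> r ^ (2 * K + 2)" by (simp only: times_divide_eq_right mult_1_right)
        then have 1: "norm (deriv G z) \<le> r ^ (2 * K + 2) * norm (G z)"
          using b(1) by (meson mult_right_mono norm_ge_zero order_trans)
        have "real N' * (1 / \<delta>) \<le> r ^ K * r ^ (K + 1)"
          using b(2) G(2) \<delta>_inv \<delta> rK by (intro mult_mono) auto
        then have "real N' * (1 / \<delta>) + r ^ K' \<le> r ^ (2 * K + 2)" using e1 e3 e3' e4 G(2) by linarith
        then have "exp (- (r ^ (2 * K + 2))) \<le> exp (- (real N' * (1 / \<delta>))) * exp (- (r ^ K'))"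
          by (simp flip: exp_add)
        also have "\<dots> = exp (- (1 / \<delta>)) ^ N' * exp (- (r ^ K'))"
          by (simp flip: exp_of_nat_mult)
        also have "exp (- (1 / \<delta>)) \<le> \<delta>"
        proof -
          have "1 / \<delta> \<le> exp (1 / \<delta>)" using exp_ge_add_one_self[of "1 / \<delta>"] by linarith
          then show ?thesis using \<delta> by (simp add: exp_minus field_simps)
        qed
        then have "exp (- (1 / \<delta>)) ^ N' * exp (- (r ^ K')) \<le> \<delta> ^ N' * exp (- (r ^ K'))"
          by (intro mult_right_mono power_mono) auto
        finally show ?thesis using 1 b(3) by linarith
      qed
      show "\<exists>s\<in>{1/2..1}. \<forall>z. norm (z - z0) = s \<longrightarrow>
         (\<forall>G\<in>{G1, G2}. exp (- (r ^ (2*K+2))) \<le> norm (G z) \<and> norm (deriv G z) \<le> r ^ (2*K+2) * norm (G z))"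
      proof (intro bexI[OF _ s(1)] allI impI ballI)
        fix z G assume z: "norm (z - z0) = s" and "G \<in> {G1, G2}"
        then consider "G = G1" | "G = G2" by blast
        then show "exp (- (r ^ (2*K+2))) \<le> norm (G z) \<and> norm (deriv G z) \<le> r ^ (2*K+2) * norm (G z)"
        proof cases
          case 1
          then show ?thesis using concl[OF z SN(1) rK(1)] by auto
        next
          case 2
          then show ?thesis using concl[OF z SN(2) rK(2)] by auto
        qed
      qed
    qed
  qed
  then show ?thesis by blast
qed


section \<open>Canonical products\<close>

lemma ln_one_plus_le_powr:
  fixes x s :: real
  assumes "x \<ge> 1" "s > 0"
  shows "ln (1 + x) \<le> (1 + 1 / s) * x powr s"
proof -
  have "ln (1 + x) \<le> ln (2 * x)" using assms by simp
  also have "\<dots> = ln 2 + ln x" using assms by (simp add: ln_mult)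
  also have "ln 2 \<le> (1::real)" using ln_le_minus_one[of 2] by simp
  also have "ln x \<le> x powr s / s"
    using ln_le_minus_one[of "x powr s"] assms by (simp add: ln_powr field_simps)
  also have "1 + x powr s / s \<le> (1 + 1 / s) * x powr s"
    using assms ge_one_powr_ge_zero[of x s] by (simp add: algebra_simps)
  finally show ?thesis by simp
qed

text \<open>
  Near \<open>0\<close> the elementary factor is \<open>1 + O(u ^ (p + 1))\<close>, away from
  \<open>0\<close> it is at most \<open>(1 + \<bar>u\<bar>) exp (p \<bar>2 u\<bar> ^ p)\<close>.
  With \<open>p \<le> s \<le> p + 1\<close>, both are absorbed by the exponent \<open>s\<close>.
\<close>
lemma weierstrass_factor_growth:
  assumes "s > 0"
  defines "C \<equiv> 3 + (1 + 1 / s + real (nat \<lfloor>s\<rfloor>)) * 2 powr s"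
  shows "norm (weierstrass_factor (nat \<lfloor>s\<rfloor>) u) \<le> exp (C * norm u powr s)"
proof -
  define p where "p = nat \<lfloor>s\<rfloor>"
  have p: "real p \<le> s" "s \<le> real (Suc p)" using assms unfolding p_def by linarith+
  have C: "3 \<le> C" "C \<ge> (1 + 1 / s + p) * 2 powr s" using assms by (simp_all add: p_def)
  show ?thesis
  proof (cases "norm u \<le> 1 / 2")
    case True
    have "norm (weierstrass_factor p u) \<le> 1 + norm (weierstrass_factor p u - 1)"
      using norm_triangle_ineq[of 1 "weierstrass_factor p u - 1"] by simp
    also have "\<dots> \<le> 1 + 3 * norm u ^ Suc p" using weierstrass_factor_bound[OF True] by simp
    also have "norm u ^ Suc p \<le> norm u powr s"
    proof (cases "u = 0")
      case False
      have "norm u ^ Suc p = norm u powr real (Suc p)" using False by (intro powr_realpow[symmetric]) simp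
      also have "\<dots> \<le> norm u powr s" using True False p by (intro powr_mono') auto
      finally show ?thesis .
    qed auto
    also have "1 + 3 * norm u powr s \<le> 1 + C * norm u powr s"
      using C by (intro add_left_mono mult_right_mono) auto
    also have "\<dots> \<le> exp (C * norm u powr s)" by simp
    finally show ?thesis by (simp add: p_def)
  next
    case False
    define y where "y = 2 * norm u"
    have y: "y \<ge> 1" "y > 0" "norm u \<le> y" using False by (auto simp: y_def)
    have "norm (\<Sum>k=1..p. u ^ k / of_nat k) \<le> (\<Sum>k=1..p. y powr s)"
    proof (rule sum_norm_le)
      fix k assume k: "k \<in> {1..p}"
      have "norm (u ^ k / of_nat k) \<le> norm u ^ k"
        using k mult_left_mono[of 1 "real k" "norm u ^ k"]
        by (auto simp: norm_divide norm_power divide_le_eq)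
      also have "\<dots> \<le> y ^ k" using y by (intro power_mono) auto
      also have "\<dots> = y powr real k" using y by (simp add: powr_realpow)
      also have "\<dots> \<le> y powr s" using y k p by (intro powr_mono) auto
      finally show "norm (u ^ k / of_nat k) \<le> y powr s" .
    qed
    then have sum: "Re (\<Sum>k=1..p. u ^ k / of_nat k) \<le> p * y powr s"
      using abs_Re_le_cmod[of "\<Sum>k=1..p. u ^ k / of_nat k"] by simp
    have "norm (1 - u) \<le> 1 + y" using y norm_triangle_ineq4[of 1 u] by simp
    also have "\<dots> = exp (ln (1 + y))" using y by simp
    also have "\<dots> \<le> exp ((1 + 1 / s) * y powr s)"
      using ln_one_plus_le_powr[OF y(1) assms(1)] by simp
    finally have lin: "norm (1 - u) \<le> exp ((1 + 1 / s) * y powr s)" .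
    have "norm (weierstrass_factor p u) = norm (1 - u) * exp (Re (\<Sum>k=1..p. u ^ k / of_nat k))"
      by (simp add: weierstrass_factor_def norm_mult)
    also have "\<dots> \<le> exp ((1 + 1 / s) * y powr s) * exp (p * y powr s)"
      using lin sum by (intro mult_mono) auto
    also have "\<dots> = exp ((1 + 1 / s + p) * 2 powr s * norm u powr s)"
      by (simp add: y_def powr_mult algebra_simps flip: exp_add)
    also have "\<dots> \<le> exp (C * norm u powr s)" using C by (simp add: mult_right_mono)
    finally show ?thesis by (simp add: p_def)
  qed
qed

lemma canonical_product_exists:
  assumes a: "\<And>n. a n \<noteq> 0" "filterlim a at_infinity at_top"
    and "s > 0" and summ: "summable (\<lambda>n. norm (a n) powr (- s))"
  obtains f C where "f holomorphic_on UNIV" "\<And>z. f z = 0 \<longleftrightarrow> z \<in> range a"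
    "\<And>z. zorder f z = card (a -` {z})" "\<And>z. norm (f z) \<le> exp (C * norm z powr s)" "C \<ge> 0"
proof -
  define p where "p = nat \<lfloor>s\<rfloor>"
  have p: "s \<le> real (Suc p)" using assms unfolding p_def by linarith+
  have quot: "(r / norm (a n)) powr s = r powr s * norm (a n) powr (- s)" if "r \<ge> 0" for r n
    using that a(1) by (simp add: powr_divide powr_minus_divide)
  interpret weierstrass_product a "\<lambda>_. p"
  proof
    fix r :: real assume r: "r > 0"
    show "summable (\<lambda>n. (r / norm (a n)) ^ Suc p)"
    proof (rule summable_comparison_test_ev)
      have "eventually (\<lambda>n. norm (a n) \<ge> r) at_top"
        using a(2) by (metis filterlim_at_infinity_imp_norm_at_top filterlim_at_top)
      then show "eventually (\<lambda>n. norm ((r / norm (a n)) ^ Suc p) \<le> (r / norm (a n)) powr s) at_top"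
      proof eventually_elim
        case (elim n)
        have "(r / norm (a n)) ^ Suc p = (r / norm (a n)) powr real (Suc p)"
          using r a(1) by (intro powr_realpow[symmetric]) simp
        also have "\<dots> \<le> (r / norm (a n)) powr s"
          using r a(1)[of n] elim p by (intro powr_mono') (auto simp: divide_le_eq)
        finally show ?case using r by simp
      qed
      show "summable (\<lambda>n. (r / norm (a n)) powr s)"
        using r summ by (simp add: quot summable_mult)
    qed
  qed (use a in auto)
  define K where "K = 3 + (1 + 1 / s + real (nat \<lfloor>s\<rfloor>)) * 2 powr s"
  have K: "K \<ge> 0" using \<open>s > 0\<close> by (simp add: K_def)
  define T where "T = (\<Sum>n. norm (a n) powr (- s))"
  have bound: "norm (f z) \<le> exp (K * T * norm z powr s)" for z
  proof -
    have "(\<lambda>n. \<Prod>i\<le>n. weierstrass_factor p (z / a i)) \<longlonglongrightarrow> f z"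
      using convergent_prod_LIMSEQ[OF convergent[of z]] by (simp add: f_def)
    then have lim: "(\<lambda>n. norm (\<Prod>i\<le>n. weierstrass_factor p (z / a i))) \<longlonglongrightarrow> norm (f z)"
      by (rule tendsto_norm)
    have "norm (\<Prod>i\<le>n. weierstrass_factor p (z / a i)) \<le> exp (K * T * norm z powr s)" for n
    proof -
      have "norm (\<Prod>i\<le>n. weierstrass_factor p (z / a i))
              \<le> (\<Prod>i\<le>n. exp (K * norm (z / a i) powr s))"
        unfolding prod_norm[symmetric] K_def p_def
        by (intro prod_mono conjI weierstrass_factor_growth \<open>s > 0\<close>) auto
      also have "\<dots> = exp (\<Sum>i\<le>n. K * norm (z / a i) powr s)" by (simp add: exp_sum)
      also have "(\<Sum>i\<le>n. K * norm (z / a i) powr s) = K * norm z powr s * (\<Sum>i\<le>n. norm (a i) powr (- s))"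
        by (simp add: norm_divide quot sum_distrib_left mult_ac)
      also have "\<dots> \<le> K * norm z powr s * T"
        unfolding T_def using K by (intro mult_left_mono sum_le_suminf summ) auto
      finally show ?thesis by (simp add: mult_ac)
    qed
    then show ?thesis by (intro LIMSEQ_le_const2[OF lim]) auto
  qed
  show ?thesis
    by (rule that[OF holomorphic zero zorder bound])
       (use K summ in \<open>auto simp: T_def intro!: mult_nonneg_nonneg suminf_nonneg\<close>)
qed

lemma bounded_on_sphere:
  assumes "f holomorphic_on UNIV"
  obtains M where "\<And>z. norm (z - c) = R \<Longrightarrow> norm (f z) \<le> M"
proof -
  have "continuous_on (sphere c R) f"
    using assms by (meson holomorphic_on_imp_continuous_on holomorphic_on_subset subset_UNIV)
  then have "bounded (f ` sphere c R)"
    by (intro compact_imp_bounded compact_continuous_image) auto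
  then obtain M where M: "\<forall>w\<in>f ` sphere c R. norm w \<le> M"
    unfolding bounded_iff by blast
  show ?thesis
  proof
    show "norm (f z) \<le> M" if "norm (z - c) = R" for z
      using M that by (auto simp: dist_norm norm_minus_commute)
  qed
qed

lemma finite_zeros_in_cball:
  assumes "A holomorphic_on UNIV" "A c \<noteq> 0"
  shows "finite {z \<in> cball c R. A z = 0}"
proof -
  define R' where "R' = max R 1"
  obtain M where M: "\<And>z. norm (z - c) = 4 * R' \<Longrightarrow> norm (A z) \<le> M"
    using bounded_on_sphere[OF assms(1)] by blast
  obtain zs H where zs: "\<And>z. A z = (\<Prod>a\<leftarrow>zs. z - a) * H z" "\<And>z. z \<in> cball c R' \<Longrightarrow> H z \<noteq> 0"
    by (rule zero_factorization[OF assms _ M]) (auto simp: R'_def)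
  have "{z \<in> cball c R. A z = 0} \<subseteq> set zs"
  proof
    fix z assume z: "z \<in> {z \<in> cball c R. A z = 0}"
    then have "H z \<noteq> 0" using zs(2)[of z] by (fastforce simp: R'_def)
    then have "(\<Prod>a\<leftarrow>zs. z - a) = 0" using zs(1)[of z] z by simp
    then show "z \<in> set zs" by (auto simp: prod_list_zero_iff)
  qed
  then show ?thesis by (rule finite_subset) simp
qed

text \<open>
  Passes from a sum over a set weighted by multiplicities to a series over a sequence that repeats
  each element as often as its multiplicity.
\<close>
lemma summable_sequence_with_multiplicities:
  fixes a :: "nat \<Rightarrow> 'a" and g :: "'a \<Rightarrow> real"
  assumes "(\<lambda>w. of_int (c w) * g w) summable_on Z" "range a \<subseteq> Z"
    "\<And>w. w \<in> Z \<Longrightarrow> finite (a -` {w}) \<and> int (card (a -` {w})) = c w" "\<And>w. g w \<ge> 0"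
  shows "summable (\<lambda>n. g (a n))"
proof (rule bounded_imp_summable)
  fix N
  have "(\<Sum>n\<le>N. g (a n)) = (\<Sum>w\<in>a ` {..N}. \<Sum>n\<in>{n\<in>{..N}. a n = w}. g (a n))"
    by (rule sum.image_gen) simp
  also have "\<dots> \<le> (\<Sum>w\<in>a ` {..N}. of_int (c w) * g w)"
  proof (rule sum_mono)
    fix w assume "w \<in> a ` {..N}"
    then have w: "finite (a -` {w})" "int (card (a -` {w})) = c w" using assms(2,3) by auto
    have "(\<Sum>n\<in>{n\<in>{..N}. a n = w}. g (a n)) = card {n\<in>{..N}. a n = w} * g w" by simp
    also have "card {n\<in>{..N}. a n = w} \<le> card (a -` {w})" by (intro card_mono w) auto
    then have "card {n\<in>{..N}. a n = w} * g w \<le> card (a -` {w}) * g w"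
      using assms(4) by (intro mult_right_mono) auto
    also have "real (card (a -` {w})) = of_int (c w)" using w(2) by (metis of_int_of_nat_eq)
    finally show "(\<Sum>n\<in>{n\<in>{..N}. a n = w}. g (a n)) \<le> of_int (c w) * g w" .
  qed
  also have "\<dots> \<le> infsum (\<lambda>w. of_int (c w) * g w) Z"
  proof (rule finite_sum_le_infsum[OF assms(1)])
    fix w assume "w \<in> Z - a ` {..N}"
    then have "c w \<ge> 0" using assms(3) by (metis DiffD1 of_nat_0_le_iff)
    then show "0 \<le> of_int (c w) * g w" using assms(4) by simp
  qed (use assms(2) in auto)
  finally show "(\<Sum>n\<le>N. g (a n)) \<le> infsum (\<lambda>w. of_int (c w) * g w) Z" .
qed (use assms(4) in auto)

text \<open>
  For infinitely many zeros \<open>v\<close> is the canonical product over the zeros other than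
  \<open>0\<close>, times a power of \<open>z\<close>; for finitely many it is a polynomial. The
  growth bound is the upper half of Borel's theorem on the order of a canonical product.
\<close>
lemma zero_divisor_of_small_growth:
  assumes A: "A holomorphic_on UNIV" "A c \<noteq> 0" and "s > 0"
    and summ: "(\<lambda>a. of_int (zorder A a) * norm a powr (- s)) summable_on {a. a \<noteq> 0 \<and> A a = 0}"
  obtains v H where "v holomorphic_on UNIV" "H holomorphic_on UNIV" "\<And>z. H z \<noteq> 0"
    "\<And>z. A z = v z * H z"
    "\<And>t. t > s \<Longrightarrow> \<forall>\<^sub>F r in at_top. \<forall>z\<in>cball 0 r. norm (v z) \<le> exp (r powr t)"
proof -
  define Z where "Z = {a. a \<noteq> 0 \<and> A a = 0}"
  have fin: "finite (Z \<inter> cball 0 r)" for r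
  proof (rule finite_subset)
    show "Z \<inter> cball 0 r \<subseteq> {z \<in> cball c (r + norm c). A z = 0}"
      unfolding Z_def using norm_triangle_ineq4[of c] by (auto simp: dist_norm) (smt (verit))
  qed (rule finite_zeros_in_cball[OF A])
  have A_an: "A analytic_on {z}" for z
    by (rule holomorphic_on_imp_analytic_at[OF A(1) open_UNIV UNIV_I])
  have ev: "\<forall>\<^sub>F w in at z. A w \<noteq> 0" for z
    using non_zero_neighbour_alt[OF A(1) open_UNIV connected_UNIV, of z c] A(2)
    by (auto elim: eventually_mono)
  have zorder_pos: "zorder A z > 0 \<longleftrightarrow> A z = 0" for z
    by (rule zorder_pos_iff[OF A(1) open_UNIV]) (use ev[of z] in \<open>auto intro: eventually_frequently\<close>)
  have zorder_nonneg: "zorder A z \<ge> 0" for z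
    by (rule zorder_ge_0[OF A_an]) (use ev[of z] in \<open>auto intro: eventually_frequently\<close>)
  show ?thesis
  proof (cases "finite Z")
    case True
    then have "finite (insert 0 Z)" by simp
    then have "bounded (insert 0 Z)" by (rule finite_imp_bounded)
    then obtain R where R: "R > 0" "insert 0 Z \<subseteq> cball c R"
      by (meson ball_subset_cball bounded_subset_ballD order_trans)
    obtain M where M: "\<And>z. norm (z - c) = 4 * R \<Longrightarrow> norm (A z) \<le> M"
      using bounded_on_sphere[OF A(1)] by blast
    obtain zs H where H: "H holomorphic_on UNIV" "\<And>z. A z = (\<Prod>a\<leftarrow>zs. z - a) * H z"
      "\<And>z. z \<in> cball c R \<Longrightarrow> H z \<noteq> 0"
      by (rule zero_factorization[OF A R(1) M]) auto
    have "H z \<noteq> 0" for z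
    proof (cases "A z = 0")
      case True
      then have "z \<in> insert 0 Z" by (auto simp: Z_def)
      then show ?thesis using R(2) H(3) by blast
    qed (use H(2)[of z] in auto)
    moreover have "(\<lambda>z. \<Prod>a\<leftarrow>zs. z - a) holomorphic_on UNIV"
      by (induction zs) (auto intro!: holomorphic_intros)
    moreover have "\<forall>\<^sub>F r in at_top. \<forall>z\<in>cball 0 r. norm (\<Prod>a\<leftarrow>zs. z - a) \<le> exp (r powr t)"
      if "t > s" for t
    proof -
      have "bounded (set zs)" by (simp add: finite_imp_bounded)
      then obtain d where d: "\<And>a. a \<in> set zs \<Longrightarrow> norm a \<le> d" by (auto simp: bounded_iff)
      have "\<forall>\<^sub>F r in at_top. (2 * r) ^ length zs \<le> exp (r powr t)"
        using that \<open>s > 0\<close> by real_asymp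
      then show ?thesis using eventually_ge_at_top[of d]
      proof eventually_elim
        case (elim r)
        have "norm (\<Prod>a\<leftarrow>zs. z - a) \<le> (2 * r) ^ length zs" if "norm z \<le> r" for z
        proof (rule norm_prod_linear_le)
          fix a assume "a \<in> set zs"
          then show "norm (z - a) \<le> 2 * r" using d[of a] elim that norm_triangle_ineq4[of z a] by linarith
        qed
        then show ?case using elim by fastforce
      qed
    qed
    ultimately show ?thesis using that H(1,2) by blast
  next
    case False
    have closed: "closed Z"
      unfolding closed_limpt
    proof (intro allI impI)
      fix x assume "x islimpt Z"
      then have "infinite (Z \<inter> ball x 1)" by (metis islimpt_eq_infinite_ball zero_less_one)
      moreover have "Z \<inter> ball x 1 \<subseteq> Z \<inter> cball 0 (norm x + 1)"
        using norm_triangle_sub[of _ x] by (auto simp: dist_norm norm_minus_commute) (smt (verit) norm_minus_commute)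
      ultimately show "x \<in> Z" using fin finite_subset by blast
    qed
    obtain a :: "nat \<Rightarrow> complex" where a: "range a = Z" "filterlim a at_infinity at_top"
      "\<And>z. z \<in> Z \<Longrightarrow> finite (a -` {z}) \<and> card (a -` {z}) = nat (zorder A z)"
      by (rule sequence_of_sparse_set_exists'[OF False closed fin, of "\<lambda>z. nat (zorder A z)"])
         (use zorder_pos in \<open>auto simp: Z_def\<close>)
    have "summable (\<lambda>n. norm (a n) powr (- s))"
      by (rule summable_sequence_with_multiplicities[where Z = Z and c = "zorder A"])
         (use a summ zorder_nonneg in \<open>auto simp: Z_def\<close>)
    moreover have a_nz: "a n \<noteq> 0" for n using a(1) by (auto simp: Z_def)
    ultimately obtain f C where f: "f holomorphic_on UNIV" "\<And>z. f z = 0 \<longleftrightarrow> z \<in> range a"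
      "\<And>z. zorder f z = card (a -` {z})" "\<And>z. norm (f z) \<le> exp (C * norm z powr s)" "C \<ge> 0"
      using canonical_product_exists[OF _ a(2) \<open>s > 0\<close>] by metis
    define m where "m = nat (zorder A 0)"
    have m0: "m = 0 \<longleftrightarrow> A 0 \<noteq> 0" using zorder_pos[of 0] by (auto simp: m_def)
    define v where "v z = z ^ m * f z" for z
    have v: "v holomorphic_on UNIV" unfolding v_def using f by (intro holomorphic_intros)
    have v0: "v z = 0 \<longleftrightarrow> A z = 0" for z
      using m0 by (auto simp: v_def f(2) a(1) Z_def)
    have v_order: "zorder v z = zorder A z" for z
    proof -
      have an: "(\<lambda>z. z ^ m) analytic_on {z}" "f analytic_on {z}"
        using f(1) by (auto intro!: analytic_intros simp: holomorphic_on_imp_analytic_at)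
      have "zorder v z = zorder (\<lambda>z. z ^ m) z + zorder f z"
        unfolding v_def
      proof (rule zorder_times_analytic[OF an])
        show "\<forall>\<^sub>F w in at z. w ^ m * f w \<noteq> 0"
          using ev[of z] by eventually_elim (use v0 in \<open>auto simp: v_def\<close>)
      qed
      also have "zorder (\<lambda>z. z ^ m) z = (if z = 0 then int m else 0)"
      proof (cases "z = 0")
        case True
        have "zorder (\<lambda>z::complex. z ^ m) 0 = int m"
          by (rule zorder_eqI[of UNIV _ "\<lambda>_. 1"]) auto
        then show ?thesis using True by simp
      next
        case False
        then show ?thesis by (auto intro!: zorder_eq_0I an)
      qed
      also have "zorder f z = (if z \<in> Z then zorder A z else 0)"
      proof (cases "z \<in> Z")
        case False
        then have "a -` {z} = {}" using a(1) by auto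
        then show ?thesis using False f(3)[of z] by simp
      qed (use f(3)[of z] a(3)[of z] zorder_nonneg[of z] in auto)
      also have "(if z = 0 then int m else 0) + (if z \<in> Z then zorder A z else 0) = zorder A z"
      proof (cases "A z = 0")
        case False
        then have "zorder A z = 0" using zorder_eq_0I[OF A_an] by auto
        then show ?thesis by (auto simp: m_def)
      qed (auto simp: Z_def m_def zorder_nonneg)
      finally show ?thesis .
    qed
    obtain H where H: "H holomorphic_on UNIV" "\<And>z. z \<in> UNIV \<Longrightarrow> H z \<noteq> 0" "\<And>z. z \<in> UNIV \<Longrightarrow> A z = H z * v z"
      using holomorphic_zorder_factorization[OF A(1) open_UNIV connected_UNIV v v0 v_order] by blast
    have "\<forall>\<^sub>F r in at_top. \<forall>z\<in>cball 0 r. norm (v z) \<le> exp (r powr t)" if "t > s" for t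
    proof -
      have "\<forall>\<^sub>F r in at_top. r ^ m * exp (C * r powr s) \<le> exp (r powr t)"
        using that \<open>s > 0\<close> f(5) by (cases "C = 0"; real_asymp)
      then show ?thesis
      proof eventually_elim
        case (elim r)
        have "norm (v z) \<le> r ^ m * exp (C * r powr s)" if "norm z \<le> r" for z
          unfolding v_def norm_mult norm_power
          by (intro mult_mono power_mono that order_trans[OF f(4)])
             (use f(5) \<open>s > 0\<close> that order_trans[OF norm_ge_zero that]
               in \<open>auto intro!: mult_left_mono powr_mono2\<close>)
        then show ?case using elim by fastforce
      qed
    qed
    then show ?thesis using that[OF v H(1), of] H(2,3) by (simp add: mult.commute)
  qed
qed

text \<open>
  Liouville's theorem with a bound that is required only on a sequence of circles: Cauchy's
  estimate for a Taylor coefficient uses one circle at a time.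
\<close>
lemma polynomial_of_frequent_growth:
  assumes "g holomorphic_on UNIV"
    and freq: "\<And>R0. \<exists>r\<ge>R0. \<forall>z. norm z = r \<longrightarrow> norm (g z) \<le> C * r ^ n"
  obtains p where "degree p \<le> n" "g = poly p"
proof
  define p where "p = (\<Sum>k\<le>n. monom ((deriv ^^ k) g 0 / fact k) k)"
  show "degree p \<le> n" unfolding p_def
    by (intro degree_sum_le) (auto intro: order_trans[OF degree_monom_le])
  have zero: "(deriv ^^ k) g 0 = 0" if "k > n" for k
  proof (rule ccontr)
    assume nz: "(deriv ^^ k) g 0 \<noteq> 0"
    define d where "d = norm ((deriv ^^ k) g 0)"
    have d: "d > 0" using nz by (simp add: d_def)
    obtain r where r: "r \<ge> 1 + fact k * \<bar>C\<bar> / d" "\<And>z. norm z = r \<Longrightarrow> norm (g z) \<le> C * r ^ n"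
      using freq by blast
    have "r \<ge> 1" using r(1) d by (smt (verit) divide_nonneg_pos fact_ge_zero mult_nonneg_nonneg)
    have "d \<le> fact k * (C * r ^ n) / r ^ k"
      unfolding d_def
    proof (rule Cauchy_inequality)
      show "continuous_on (cball 0 r) g" "g holomorphic_on ball 0 r"
        using assms(1) by (meson holomorphic_on_imp_continuous_on holomorphic_on_subset subset_UNIV)+
    qed (use r(2) \<open>r \<ge> 1\<close> in auto)
    also have "\<dots> \<le> fact k * (\<bar>C\<bar> * r ^ n) / r ^ k"
      using \<open>r \<ge> 1\<close> by (intro divide_right_mono mult_left_mono mult_right_mono) auto
    also have "r ^ k = r ^ n * r ^ (k - n)" using that by (simp flip: power_add)
    also have "fact k * (\<bar>C\<bar> * r ^ n) / (r ^ n * r ^ (k - n)) = fact k * \<bar>C\<bar> / r ^ (k - n)"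
      using \<open>r \<ge> 1\<close> by simp
    also have "\<dots> \<le> fact k * \<bar>C\<bar> / r ^ 1"
      using \<open>r \<ge> 1\<close> that by (intro divide_left_mono power_increasing) auto
    finally have "d * r \<le> fact k * \<bar>C\<bar>" using \<open>r \<ge> 1\<close> by (simp add: field_simps)
    moreover have "d * r \<ge> d + fact k * \<bar>C\<bar>"
      using mult_left_mono[OF r(1), of d] d by (simp add: algebra_simps)
    ultimately show False using d by simp
  qed
  show "g = poly p"
  proof
    fix z
    have "((\<lambda>k. (deriv ^^ k) g 0 / fact k * (z - 0) ^ k) sums g z)"
      by (rule holomorphic_power_series[where r = "norm z + 1"])
         (use assms(1) holomorphic_on_subset in auto)
    moreover have "((\<lambda>k. (deriv ^^ k) g 0 / fact k * (z - 0) ^ k) sums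
                     (\<Sum>k\<le>n. (deriv ^^ k) g 0 / fact k * (z - 0) ^ k))"
      by (rule sums_finite) (auto simp: zero)
    ultimately show "g z = poly p z"
      using sums_unique2 by (fastforce simp: p_def poly_sum poly_monom)
  qed
qed

text \<open>
  For \<open>H = exp h\<close> the bound is one on \<open>Re h\<close>, which the
  Borel-Caratheodory theorem turns into one on \<open>h\<close>.
\<close>
lemma zero_free_of_frequent_growth:
  assumes H: "H holomorphic_on UNIV" "\<And>z. H z \<noteq> 0"
    and freq: "\<exists>\<^sub>F r in at_top. \<forall>z. norm z = r \<longrightarrow> norm (H z) \<le> exp (r ^ K)"
  obtains p where "\<And>z. H z = exp (poly p z)"
proof -
  obtain h where h: "h holomorphic_on UNIV" "\<And>z. exp (h z) = H z"
    using holomorphic_logarithm_exists[of UNIV H 0] H by auto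
  define g where "g z = h z - h 0" for z
  have g: "g holomorphic_on UNIV" unfolding g_def by (intro holomorphic_intros h)
  define C where "C = 2 * (2 + norm (h 0)) * 2 ^ K"
  have "\<exists>r\<ge>R0. \<forall>z. norm z = r \<longrightarrow> norm (g z) \<le> C * r ^ K" for R0
  proof -
    have "\<exists>\<^sub>F r in at_top. r \<ge> max 2 (2 * R0) \<and> (\<forall>z. norm z = r \<longrightarrow> norm (H z) \<le> exp (r ^ K))"
      using frequently_eventually_conj[OF freq eventually_ge_at_top[of "max 2 (2 * R0)"]]
      by (simp add: conj_commute)
    then obtain r where r: "r \<ge> 2" "r \<ge> 2 * R0" "\<And>z. norm z = r \<Longrightarrow> norm (H z) \<le> exp (r ^ K)"
      by (auto dest!: frequently_ex)
    have cont: "continuous_on S h" for S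
      using h(1) by (meson holomorphic_on_imp_continuous_on holomorphic_on_subset subset_UNIV)
    have Re_h: "Re (h z) \<le> r ^ K" if "norm z \<le> r" for z
    proof (rule maximum_real_frontier[of h "cball 0 r"])
      show "h holomorphic_on interior (cball 0 r)" using h(1) by (rule holomorphic_on_subset) simp
      show "Re (h w) \<le> r ^ K" if "w \<in> frontier (cball 0 r)" for w
        using r(3)[of w] that h(2)[of w, symmetric] by simp
    qed (use that cont in auto)
    define L where "L = r ^ K + norm (h 0) + 1"
    have "norm (g z) \<le> C * (r / 2) ^ K" if "norm z = r / 2" for z
    proof -
      have "norm (g z) \<le> 2 * L"
      proof (rule Borel_Caratheodory[where c = 0 and R = r and g = g and L = L and z = z])
        show "g holomorphic_on ball 0 r" using g by (rule holomorphic_on_subset) simp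
        show "Re (g w) < L" if "w \<in> ball 0 r" for w
          using Re_h[of w] that abs_Re_le_cmod[of "h 0"] by (simp add: g_def L_def)
      qed (use r that in \<open>auto simp: g_def\<close>)
      also have "\<dots> \<le> 2 * ((2 + norm (h 0)) * r ^ K)"
      proof -
        have "1 \<le> r ^ K" using r(1) by (intro one_le_power) simp
        then have "(1 + norm (h 0)) * 1 \<le> (1 + norm (h 0)) * r ^ K" by (intro mult_left_mono) auto
        then show ?thesis by (simp add: L_def algebra_simps)
      qed
      also have "\<dots> = C * (r / 2) ^ K" by (simp add: C_def power_divide)
      finally show ?thesis .
    qed
    then show ?thesis using r(2) by (intro exI[of _ "r / 2"]) auto
  qed
  then obtain p where p: "g = poly p" using polynomial_of_frequent_growth[OF g] by metis
  show ?thesis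
  proof
    show "H z = exp (poly (p + [:h 0:]) z)" for z
      using h(2)[of z] fun_cong[OF p, of z] by (simp add: g_def) (metis diff_add_cancel)
  qed
qed


section \<open>The Phragmen-Lindelof principle\<close>

text \<open>
  The exponential map turns a sector into this half-strip, and turns \<open>exp (r powr d)\<close>
  into \<open>exp (exp (d * x))\<close>. The function \<open>exp (- \<eta> exp (d'
  \<zeta>))\<close> decays in the half-strip because \<open>d' * \<beta> < pi / 2\<close>, and it
  beats the growth of \<open>F\<close> because \<open>d < d'\<close>. As the maximum principle is
  applied to rectangles, control of \<open>F\<close> on arbitrarily distant vertical sides is
  enough.
\<close>
lemma Phragmen_Lindelof_half_strip:
  fixes F :: "complex \<Rightarrow> complex"
  assumes F: "F holomorphic_on UNIV" and "0 < \<beta>" "d < d'" "0 < d'" "d' * \<beta> < pi / 2"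
    and "0 \<le> C" "1 \<le> K" "0 \<le> x0"
    and sides: "\<And>\<zeta>. Re \<zeta> \<ge> x0 \<Longrightarrow> \<bar>Im \<zeta>\<bar> = \<beta> \<Longrightarrow> norm (F \<zeta>) \<le> K * exp (C * Re \<zeta>)"
    and left: "\<And>\<zeta>. Re \<zeta> = x0 \<Longrightarrow> \<bar>Im \<zeta>\<bar> \<le> \<beta> \<Longrightarrow> norm (F \<zeta>) \<le> K * exp (C * Re \<zeta>)"
    and right: "\<exists>\<^sub>F x in at_top. \<forall>\<zeta>. Re \<zeta> = x \<longrightarrow> \<bar>Im \<zeta>\<bar> \<le> \<beta> \<longrightarrow> norm (F \<zeta>) \<le> exp (exp (d * x))"
    and \<zeta>: "Re \<zeta> \<ge> x0" "\<bar>Im \<zeta>\<bar> \<le> \<beta>"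
  shows "norm (F \<zeta>) \<le> K * exp (C * Re \<zeta>)"
proof -
  define c where "c = cos (d' * \<beta>)"
  have "c > 0" unfolding c_def using assms(2-5)
    by (intro cos_gt_zero_pi) (auto intro: less_le_trans[of _ 0] simp: mult_pos_pos)
  have cos_ge: "cos (d' * y) \<ge> c" if "\<bar>y\<bar> \<le> \<beta>" for y
  proof -
    have "d' * \<beta> \<le> pi" using assms(5) pi_gt_zero by linarith
    then have "cos (d' * \<beta>) \<le> cos \<bar>d' * y\<bar>"
      using that assms(2-5) by (intro cos_monotone_0_pi_le) (auto simp: abs_mult)
    then show ?thesis by (simp add: c_def)
  qed
  have main: "norm (F \<zeta>) \<le> K * exp (C * Re \<zeta>) * exp (\<eta> * exp (d' * Re \<zeta>))" if "\<eta> > 0" for \<eta>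
  proof -
    \<comment> \<open>the comparison function, with the polynomial bound already divided out\<close>
    define \<Phi> where "\<Phi> w = F w * exp (- C * w - \<eta> * exp (d' * w))" for w :: complex
    have \<Phi>: "norm (\<Phi> w) = norm (F w) * exp (- C * Re w - \<eta> * (exp (d' * Re w) * cos (d' * Im w)))" for w
      by (simp add: \<Phi>_def norm_mult Re_exp)
    have \<Phi>_le: "norm (\<Phi> w) \<le> norm (F w) * exp (- C * Re w - \<eta> * c * exp (d' * Re w))"
      if "\<bar>Im w\<bar> \<le> \<beta>" for w
      using cos_ge[OF that] \<open>\<eta> > 0\<close> by (auto simp: \<Phi> mult_ac intro!: mult_left_mono)
    have \<Phi>_hol: "\<Phi> holomorphic_on S" for S
      unfolding \<Phi>_def using F by (intro holomorphic_intros) (auto intro: holomorphic_on_subset)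
    have small: "norm (\<Phi> w) \<le> K" if "\<bar>Im w\<bar> \<le> \<beta>" "norm (F w) \<le> K * exp (C * Re w)" for w
    proof -
      have "norm (\<Phi> w) \<le> (K * exp (C * Re w)) * exp (- C * Re w)"
        using that \<open>\<eta> > 0\<close> \<open>c > 0\<close> \<open>1 \<le> K\<close>
        by (intro order_trans[OF \<Phi>_le] mult_mono) auto
      then show ?thesis by (simp add: mult.assoc flip: exp_add)
    qed
    have "\<forall>\<^sub>F x in at_top. exp (d * x) \<le> \<eta> * c * exp (d' * x)"
    proof -
      have "filterlim (\<lambda>x. (d' - d) * x) at_top at_top"
        using \<open>d < d'\<close> by (intro filterlim_tendsto_pos_mult_at_top[OF tendsto_const] filterlim_ident) auto
      then have "\<forall>\<^sub>F x in at_top. - ln (\<eta> * c) \<le> (d' - d) * x"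
        by (simp add: filterlim_at_top)
      then show ?thesis
      proof eventually_elim
        case (elim x)
        then have "d * x \<le> ln (\<eta> * c) + d' * x" by (simp add: algebra_simps)
        then have "exp (d * x) \<le> exp (ln (\<eta> * c) + d' * x)" by simp
        then show ?case using \<open>\<eta> > 0\<close> \<open>c > 0\<close> by (simp add: exp_add)
      qed
    qed
    then have "\<forall>\<^sub>F x in at_top. exp (d * x) \<le> \<eta> * c * exp (d' * x) \<and> x \<ge> Re \<zeta> + 1"
      using eventually_ge_at_top[of "Re \<zeta> + 1"] by eventually_elim auto
    from frequently_eventually_conj[OF right this] obtain x where
      x: "\<And>w. Re w = x \<Longrightarrow> \<bar>Im w\<bar> \<le> \<beta> \<Longrightarrow> norm (F w) \<le> exp (exp (d * x))"
      "exp (d * x) \<le> \<eta> * c * exp (d' * x)" "x \<ge> Re \<zeta> + 1"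
      by (auto dest!: frequently_ex)
    define S where "S = cbox (Complex x0 (- \<beta>)) (Complex x \<beta>)"
    have S: "w \<in> S \<longleftrightarrow> x0 \<le> Re w \<and> Re w \<le> x \<and> \<bar>Im w\<bar> \<le> \<beta>" for w
      by (auto simp: S_def in_cbox_complex_iff)
    have int: "interior S = box (Complex x0 (- \<beta>)) (Complex x \<beta>)" unfolding S_def by (rule interior_cbox)
    have "norm (\<Phi> \<zeta>) \<le> K"
    proof (rule maximum_modulus_frontier[of \<Phi> S])
      show "continuous_on (closure S) \<Phi>" by (intro holomorphic_on_imp_continuous_on \<Phi>_hol)
      show "bounded S" unfolding S_def by (rule bounded_cbox)
      fix w assume "w \<in> frontier S"
      then have w: "w \<in> S" "w \<notin> interior S" using S_def by (auto simp: frontier_def)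
      then consider "Re w = x0" | "\<bar>Im w\<bar> = \<beta>" | "Re w = x"
        unfolding S int in_box_complex_iff by fastforce
      then show "norm (\<Phi> w) \<le> K"
      proof cases
        case 3
        have "norm (\<Phi> w) \<le> exp (exp (d * x)) * exp (- C * Re w - \<eta> * c * exp (d' * Re w))"
          using x(1)[OF 3] w(1) S by (intro order_trans[OF \<Phi>_le] mult_right_mono) auto
        also have "\<dots> \<le> 1"
        proof -
          have "0 \<le> C * x" using x(3) \<zeta>(1) assms(6,8) by (intro mult_nonneg_nonneg) auto
          then have "exp (d * x) + (- C * Re w - \<eta> * c * exp (d' * Re w)) \<le> 0"
            using x(2) 3 by simp
          then show ?thesis by (simp only: exp_add[symmetric] exp_le_one_iff)
        qed
        finally show ?thesis using \<open>1 \<le> K\<close> by simp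
      qed (use small left sides w S in auto)
    qed (use \<zeta> x \<Phi>_hol S in auto)
    have "norm (F \<zeta>) = norm (\<Phi> \<zeta>) * exp (C * Re \<zeta> + \<eta> * (exp (d' * Re \<zeta>) * cos (d' * Im \<zeta>)))"
      by (simp add: \<Phi> flip: exp_add)
    also have "\<dots> \<le> K * exp (C * Re \<zeta> + \<eta> * exp (d' * Re \<zeta>))"
      using \<open>norm (\<Phi> \<zeta>) \<le> K\<close> \<open>\<eta> > 0\<close> \<open>1 \<le> K\<close>
      by (intro mult_mono) (auto intro!: mult_left_mono mult_left_le)
    finally show ?thesis by (simp add: exp_add mult_ac)
  qed
  have "((\<lambda>\<eta>. K * exp (C * Re \<zeta>) * exp (\<eta> * exp (d' * Re \<zeta>))) \<longlongrightarrow>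
          K * exp (C * Re \<zeta>) * exp (0 * exp (d' * Re \<zeta>))) (at_right 0)"
    by (intro tendsto_intros)
  then have "norm (F \<zeta>) \<le> K * exp (C * Re \<zeta>) * exp (0 * exp (d' * Re \<zeta>))"
  proof (rule tendsto_lowerbound)
    show "\<forall>\<^sub>F \<eta> in at_right 0. norm (F \<zeta>) \<le> K * exp (C * Re \<zeta>) * exp (\<eta> * exp (d' * Re \<zeta>))"
      using eventually_at_right_less[of 0] by eventually_elim (rule main)
  qed simp
  then show ?thesis by simp
qed


section \<open>Comparing the coefficients of the equation\<close>

lemma frequently_at_top_compose:
  fixes g h :: "real \<Rightarrow> real"
  assumes "\<exists>\<^sub>F r in at_top. P r" "filterlim g at_top at_top" "\<forall>\<^sub>F r in at_top. h (g r) = r"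
  shows "\<exists>\<^sub>F r in at_top. P (h r)"
proof (rule ccontr)
  assume "\<not> ?thesis"
  then have "\<forall>\<^sub>F r in at_top. \<not> P (h r)" by (simp add: frequently_def)
  then have "\<forall>\<^sub>F r in at_top. \<not> P (h (g r))"
    by (rule eventually_compose_filterlim) (rule assms(2))
  then have "\<forall>\<^sub>F r in at_top. \<not> P r"
    using assms(3) by eventually_elim simp
  then show False using assms(1) by (simp add: frequently_def)
qed

lemma norm_centre_le:
  assumes "g holomorphic_on UNIV" "s \<ge> 0" "\<And>z. norm (z - z0) = s \<Longrightarrow> norm (g z) \<le> K"
  shows "norm (g z0) \<le> K"
proof (rule maximum_modulus_frontier[of g "cball z0 s"])
  show "g holomorphic_on interior (cball z0 s)" using assms(1) by (rule holomorphic_on_subset) simp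
  show "continuous_on (closure (cball z0 s)) g"
    using assms(1) by (meson holomorphic_on_imp_continuous_on holomorphic_on_subset subset_UNIV)
  show "norm (g z) \<le> K" if "z \<in> frontier (cball z0 s)" for z
    using that by (intro assms(3)) (simp add: dist_norm norm_minus_commute)
qed (use assms in auto)

lemma finite_order_powr:
  assumes "\<forall>\<^sub>F r in at_top. \<forall>z\<in>cball 0 r. norm (f z) \<le> exp (r powr t)"
  shows "finite_order f"
  unfolding finite_order_def
proof
  show "\<forall>\<^sub>F r in at_top. \<forall>z\<in>cball 0 r. norm (f z) \<le> exp (r ^ nat \<lceil>t\<rceil>)"
    using assms eventually_ge_at_top[of 1]
  proof eventually_elim
    case (elim r)
    have "r powr t \<le> r powr real (nat \<lceil>t\<rceil>)" using elim(2) by (intro powr_mono) linarith+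
    then have "r powr t \<le> r ^ nat \<lceil>t\<rceil>" using elim(2) by (simp add: powr_realpow)
    then show ?case using elim(1) by (meson exp_le_cancel_iff order_trans)
  qed
qed

text \<open>
  The equation divided by \<open>f\<close> bounds \<open>B\<close>, since \<open>f'/f\<close> and
  \<open>f''/f\<close> are polynomially bounded on good circles. Divided by \<open>f'\<close> it
  bounds \<open>A\<close>; here the quotient \<open>f/f'\<close> is only known to be at most
  exponential in a power of \<open>r\<close>.
\<close>
lemma ode_coefficient_bounds:
  assumes f: "f holomorphic_on UNIV" "f c \<noteq> 0" "finite_order f"
    and ode: "\<And>z. deriv (deriv f) z + A z * deriv f z + B z * f z = 0"
    and B: "B holomorphic_on UNIV" "B b \<noteq> 0"
  shows "\<exists>K. \<forall>\<^sub>F r in at_top. \<forall>z0::complex. norm z0 = r \<longrightarrow> (\<exists>s\<in>{1/2..1}. \<forall>z. norm (z - z0) = s \<longrightarrow>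
           norm (B z) \<le> r ^ K * (1 + norm (A z)) \<and> norm (A z) \<le> exp (r ^ K) * (1 + norm (B z)))"
proof -
  have f': "deriv f holomorphic_on UNIV" using f(1) by (rule holomorphic_deriv) simp
  have nz: "\<exists>c. deriv f c \<noteq> 0"
  proof (rule ccontr)
    assume "\<not> ?thesis"
    then have 0: "deriv f = (\<lambda>_. 0)" by auto
    have "\<exists>k. \<forall>z\<in>UNIV. f z = k"
      using f(1) 0 by (intro has_field_derivative_zero_constant) (auto dest: holomorphic_derivI)
    then have "f b \<noteq> 0" using f(2) by auto
    then show False using ode[of b] 0 B(2) by simp
  qed
  obtain K where K: "\<forall>\<^sub>F r in at_top. \<forall>z0::complex. norm z0 = r \<longrightarrow> (\<exists>s\<in>{1/2..1}. \<forall>z. norm (z - z0) = s \<longrightarrow>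
     (\<forall>G\<in>{f, deriv f}. exp (- (r ^ K)) \<le> norm (G z) \<and> norm (deriv G z) \<le> r ^ K * norm (G z)))"
    using good_circles[of f "deriv f"] f f' nz finite_order_deriv[OF f(1,3)] by auto
  obtain k where k: "\<forall>\<^sub>F r::real in at_top. \<forall>z\<in>cball 0 r. norm (f z) \<le> exp (r ^ k)"
    using f(3) unfolding finite_order_def by blast
  have k': "\<forall>\<^sub>F r::real in at_top. \<forall>z\<in>cball 0 (2 * r). norm (f z) \<le> exp ((2 * r) ^ k)"
    by (rule eventually_compose_filterlim[OF k]) real_asymp
  define m where "m = 2 * max k K + 1"
  have "\<forall>\<^sub>F r in at_top. \<forall>z0::complex. norm z0 = r \<longrightarrow> (\<exists>s\<in>{1/2..1}. \<forall>z. norm (z - z0) = s \<longrightarrow>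
           norm (B z) \<le> r ^ m * (1 + norm (A z)) \<and> norm (A z) \<le> exp (r ^ m) * (1 + norm (B z)))"
    using K k' eventually_ge_at_top[of "2 ^ k + 1"]
  proof eventually_elim
    case (elim r)
    have r: "r \<ge> 1" using elim(3) by (smt (verit) zero_le_power)
    have rm: "r ^ K * r ^ K \<le> r ^ m" "r ^ K \<le> r ^ m"
      unfolding power_add[symmetric] using r by (rule_tac [!] power_increasing) (auto simp: m_def)
    have "(2 * r) ^ k + r ^ K \<le> 2 ^ k * r ^ (max k K) + r ^ (max k K)"
      unfolding power_mult_distrib using r by (intro add_mono mult_left_mono power_increasing) auto
    also have "\<dots> = (2 ^ k + 1) * r ^ (max k K)" by (simp add: algebra_simps)
    also have "\<dots> \<le> r * r ^ (max k K)" using elim(3) r by (intro mult_right_mono) auto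
    also have "\<dots> \<le> r ^ m" unfolding power_Suc[symmetric] m_def using r by (intro power_increasing) auto
    finally have exponent: "(2 * r) ^ k + r ^ K \<le> r ^ m" .
    show ?case
    proof (intro allI impI)
      fix z0 :: complex assume z0: "norm z0 = r"
      from elim(1)[rule_format, OF z0] obtain s where s: "s \<in> {1/2..1}"
        "\<And>z. norm (z - z0) = s \<Longrightarrow> (\<forall>G\<in>{f, deriv f}. exp (- (r ^ K)) \<le> norm (G z) \<and> norm (deriv G z) \<le> r ^ K * norm (G z))"
        by blast
      show "\<exists>s\<in>{1/2..1}. \<forall>z. norm (z - z0) = s \<longrightarrow>
           norm (B z) \<le> r ^ m * (1 + norm (A z)) \<and> norm (A z) \<le> exp (r ^ m) * (1 + norm (B z))"
      proof (intro bexI[OF _ s(1)] allI impI)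
        fix z assume z: "norm (z - z0) = s"
        from s(2)[OF z] have b: "exp (- (r ^ K)) \<le> norm (f z)" "norm (deriv f z) \<le> r ^ K * norm (f z)"
          "exp (- (r ^ K)) \<le> norm (deriv f z)" "norm (deriv (deriv f) z) \<le> r ^ K * norm (deriv f z)" by auto
        have pos: "norm (f z) > 0" "norm (deriv f z) > 0"
          using b(1,3) exp_gt_zero less_le_trans by blast+
        have "norm z \<le> 2 * r" using z s(1) z0 r norm_triangle_ineq[of "z - z0" z0] by simp
        then have fz: "norm (f z) \<le> exp ((2 * r) ^ k)" using elim(2) by simp
        have "B z * f z = - (deriv (deriv f) z + A z * deriv f z)"
          using ode[of z] by (simp add: eq_neg_iff_add_eq_0 algebra_simps)
        then have "norm (B z) * norm (f z) \<le> norm (deriv (deriv f) z) + norm (A z) * norm (deriv f z)"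
          by (metis norm_minus_cancel norm_mult norm_triangle_ineq)
        also have "\<dots> \<le> r ^ K * (r ^ K * norm (f z)) + norm (A z) * (r ^ K * norm (f z))"
          using b(2,4) r by (intro add_mono mult_left_mono order_trans[OF b(4)]) auto
        also have "\<dots> = (r ^ K * r ^ K + norm (A z) * r ^ K) * norm (f z)" by (simp add: algebra_simps)
        also have "\<dots> \<le> (r ^ m + norm (A z) * r ^ m) * norm (f z)"
          using rm by (intro mult_right_mono add_mono mult_left_mono) auto
        finally have "norm (B z) \<le> r ^ m + norm (A z) * r ^ m"
          using pos by (simp only: mult_le_cancel_right_pos)
        then have 1: "norm (B z) \<le> r ^ m * (1 + norm (A z))" by (simp add: algebra_simps)
        have "A z * deriv f z = - (deriv (deriv f) z + B z * f z)"
          using ode[of z] by (simp add: eq_neg_iff_add_eq_0 algebra_simps)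
        then have "norm (A z) * norm (deriv f z) \<le> norm (deriv (deriv f) z) + norm (B z) * norm (f z)"
          by (metis norm_minus_cancel norm_mult norm_triangle_ineq)
        also have "norm (f z) \<le> exp ((2 * r) ^ k + r ^ K) * norm (deriv f z)"
        proof -
          have "norm (f z) \<le> exp ((2 * r) ^ k) * (exp (r ^ K) * exp (- (r ^ K)))"
            using fz by (simp flip: exp_add)
          also have "\<dots> \<le> exp ((2 * r) ^ k) * (exp (r ^ K) * norm (deriv f z))"
            using b(3) by (intro mult_left_mono) auto
          finally show ?thesis by (simp add: exp_add mult.assoc)
        qed
        also have "exp ((2 * r) ^ k + r ^ K) \<le> exp (r ^ m)" using exponent by simp
        also have "norm (deriv (deriv f) z) \<le> exp (r ^ m) * norm (deriv f z)"
        proof -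
          have "r ^ K \<le> exp (r ^ m)" using rm(2) exp_ge_add_one_self[of "r ^ m"] by linarith
          then show ?thesis using b(4) by (meson mult_right_mono norm_ge_zero order_trans)
        qed
        finally have "norm (A z) * norm (deriv f z) \<le> exp (r ^ m) * (1 + norm (B z)) * norm (deriv f z)"
          by (simp add: algebra_simps mult_right_mono mult_left_mono)
        then have 2: "norm (A z) \<le> exp (r ^ m) * (1 + norm (B z))" using pos by simp
        show "norm (B z) \<le> r ^ m * (1 + norm (A z)) \<and> norm (A z) \<le> exp (r ^ m) * (1 + norm (B z))"
          using 1 2 by blast
      qed
    qed
  qed
  then show ?thesis by blast
qed

lemma ode_pointwise_bounds:
  assumes f: "f holomorphic_on UNIV" "f c \<noteq> 0" "finite_order f"
    and ode: "\<And>z. deriv (deriv f) z + A z * deriv f z + B z * f z = 0"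
    and A: "A holomorphic_on UNIV" and B: "B holomorphic_on UNIV" "B b \<noteq> 0"
  shows "\<exists>K. \<forall>\<^sub>F r in at_top. \<forall>(z0::complex) M. norm z0 = r \<longrightarrow>
     ((\<forall>z\<in>cball z0 1. norm (A z) \<le> M) \<longrightarrow> norm (B z0) \<le> r ^ K * (1 + M)) \<and>
     ((\<forall>z\<in>cball z0 1. norm (B z) \<le> M) \<longrightarrow> norm (A z0) \<le> exp (r ^ K) * (1 + M))"
proof -
  obtain K where "\<forall>\<^sub>F r in at_top. \<forall>z0::complex. norm z0 = r \<longrightarrow> (\<exists>s\<in>{1/2..1}. \<forall>z. norm (z - z0) = s \<longrightarrow>
           norm (B z) \<le> r ^ K * (1 + norm (A z)) \<and> norm (A z) \<le> exp (r ^ K) * (1 + norm (B z)))"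
    using ode_coefficient_bounds[OF f ode B] by blast
  then have "\<forall>\<^sub>F r in at_top. \<forall>(z0::complex) M. norm z0 = r \<longrightarrow>
     ((\<forall>z\<in>cball z0 1. norm (A z) \<le> M) \<longrightarrow> norm (B z0) \<le> r ^ K * (1 + M)) \<and>
     ((\<forall>z\<in>cball z0 1. norm (B z) \<le> M) \<longrightarrow> norm (A z0) \<le> exp (r ^ K) * (1 + M))"
    using eventually_ge_at_top[of 0]
  proof eventually_elim
    case (elim r)
    show ?case
    proof (intro allI impI)
      fix z0 :: complex and M assume z0: "norm z0 = r"
      then obtain s where s: "s \<in> {1/2..1}" "\<And>z. norm (z - z0) = s \<Longrightarrow>
           norm (B z) \<le> r ^ K * (1 + norm (A z)) \<and> norm (A z) \<le> exp (r ^ K) * (1 + norm (B z))"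
        using elim(1) by blast
      have in_cball: "z \<in> cball z0 1" if "norm (z - z0) = s" for z
        using that s(1) by (simp add: dist_norm norm_minus_commute)
      have "norm (B z0) \<le> r ^ K * (1 + M)" if M: "\<forall>z\<in>cball z0 1. norm (A z) \<le> M"
      proof (rule norm_centre_le[OF B(1)])
        fix z assume z: "norm (z - z0) = s"
        have "r ^ K * (1 + norm (A z)) \<le> r ^ K * (1 + M)"
          using M in_cball[OF z] elim(2) by (intro mult_left_mono) auto
        then show "norm (B z) \<le> r ^ K * (1 + M)" using s(2)[OF z] by linarith
      qed (use s in auto)
      moreover have "norm (A z0) \<le> exp (r ^ K) * (1 + M)" if M: "\<forall>z\<in>cball z0 1. norm (B z) \<le> M"
      proof (rule norm_centre_le[OF A])
        fix z assume z: "norm (z - z0) = s"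
        have "exp (r ^ K) * (1 + norm (B z)) \<le> exp (r ^ K) * (1 + M)"
          using M in_cball[OF z] by (intro mult_left_mono) auto
        then show "norm (A z) \<le> exp (r ^ K) * (1 + M)" using s(2)[OF z] by linarith
      qed (use s in auto)
      ultimately show "((\<forall>z\<in>cball z0 1. norm (A z) \<le> M) \<longrightarrow> norm (B z0) \<le> r ^ K * (1 + M)) \<and>
        ((\<forall>z\<in>cball z0 1. norm (B z) \<le> M) \<longrightarrow> norm (A z0) \<le> exp (r ^ K) * (1 + M))" by blast
    qed
  qed
  then show ?thesis by blast
qed

lemma norm_le_max_modulus_unit_disc:
  assumes "f holomorphic_on UNIV" "norm z0 = r"
  shows "\<forall>z\<in>cball z0 1. norm (f z) \<le> max_modulus (r + 1) f"
proof
  fix z assume "z \<in> cball z0 1"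
  then have "norm z \<le> r + 1"
    using assms(2) norm_triangle_ineq[of "z - z0" z0] by (simp add: dist_norm norm_minus_commute)
  then show "norm (f z) \<le> max_modulus (r + 1) f" by (rule norm_le_max_modulus[OF assms(1)])
qed

lemma lower_order_frequent_shift:
  assumes "f holomorphic_on UNIV" "lower_growth_order f < ereal c" "c > 0"
  shows "\<exists>\<^sub>F r in at_top. max_modulus (r + 1) f \<le> exp ((r + 1) powr c)"
proof -
  have freq: "\<exists>\<^sub>F r in at_top. max_modulus r f \<le> exp (r powr c)"
    using assms by (intro lower_growth_order_lessD) auto
  have "filterlim (\<lambda>r::real. r - 1) at_top at_top" by real_asymp
  from frequently_at_top_compose[OF freq this, of "\<lambda>r. r + 1"] show ?thesis by simp
qed

text \<open>
  A factor \<open>r ^ K\<close> and a shift of the radius by \<open>1\<close> do not change the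
  lower order.
\<close>
lemma ode_lower_order_le:
  assumes f: "f holomorphic_on UNIV" "f c \<noteq> 0" "finite_order f"
    and ode: "\<And>z. deriv (deriv f) z + A z * deriv f z + B z * f z = 0"
    and A: "A holomorphic_on UNIV" and B: "B holomorphic_on UNIV" "B b \<noteq> 0"
  shows "lower_growth_order B \<le> lower_growth_order A"
proof (rule ccontr)
  assume "\<not> ?thesis"
  then have less: "lower_growth_order A < lower_growth_order B" by simp
  obtain c where c: "lower_growth_order A < ereal c" "ereal c < lower_growth_order B"
    using ereal_dense2[OF less] by blast
  obtain c' where c': "ereal c < ereal c'" "ereal c' < lower_growth_order B"
    using ereal_dense2[OF c(2)] by blast
  have "0 < ereal c" using lower_growth_order_nonneg[of A] c(1) by (rule le_less_trans)
  then have cc: "0 < c" "c < c'" using c' by auto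
  obtain K where K: "\<forall>\<^sub>F r in at_top. \<forall>(z0::complex) M. norm z0 = r \<longrightarrow>
     ((\<forall>z\<in>cball z0 1. norm (A z) \<le> M) \<longrightarrow> norm (B z0) \<le> r ^ K * (1 + M)) \<and>
     ((\<forall>z\<in>cball z0 1. norm (B z) \<le> M) \<longrightarrow> norm (A z0) \<le> exp (r ^ K) * (1 + M))"
    using ode_pointwise_bounds[OF f ode A B] by blast
  have asymp: "\<forall>\<^sub>F r in at_top. r ^ K * (1 + exp ((r + 1) powr c)) \<le> exp (r powr c')"
    using cc by real_asymp
  have ev: "\<forall>\<^sub>F r in at_top. max_modulus (r + 1) A \<le> exp ((r + 1) powr c) \<longrightarrow>
                             max_modulus r B \<le> exp (r powr c')"
    using K asymp eventually_ge_at_top[of 0]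
  proof eventually_elim
    case (elim r)
    show ?case
    proof
      assume MA: "max_modulus (r + 1) A \<le> exp ((r + 1) powr c)"
      show "max_modulus r B \<le> exp (r powr c')"
      proof (rule max_modulus_le[OF elim(3)])
        fix z0 :: complex assume z0: "norm z0 = r"
        have "norm (B z0) \<le> r ^ K * (1 + max_modulus (r + 1) A)"
          using elim(1) z0 norm_le_max_modulus_unit_disc[OF A z0] by blast
        also have "\<dots> \<le> r ^ K * (1 + exp ((r + 1) powr c))"
          using MA elim(3) by (intro mult_left_mono) auto
        finally show "norm (B z0) \<le> exp (r powr c')" using elim(2) by linarith
      qed
    qed
  qed
  have "\<exists>\<^sub>F r in at_top. max_modulus r B \<le> exp (r powr c')"
    using frequently_mp[OF ev lower_order_frequent_shift[OF A c(1) cc(1)]] .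
  then have "lower_growth_order B \<le> ereal c'"
    using cc by (intro lower_growth_order_le[OF B(1)]) auto
  then show False using c'(2) by simp
qed

text \<open>
  Here \<open>A\<close> is recovered from \<open>f\<close> and \<open>B\<close>, so that its lower
  order is finite, being controlled by the order of \<open>f\<close> and the lower order of
  \<open>B\<close>.
\<close>
lemma ode_frequent_growth:
  assumes f: "f holomorphic_on UNIV" "f c \<noteq> 0" "finite_order f"
    and ode: "\<And>z. deriv (deriv f) z + A z * deriv f z + B z * f z = 0"
    and A: "A holomorphic_on UNIV" and B: "B holomorphic_on UNIV" "B b \<noteq> 0"
    and fin: "lower_growth_order B < \<infinity>"
  shows "\<exists>K. \<exists>\<^sub>F r in at_top. \<forall>z\<in>cball 0 r. norm (A z) \<le> exp (r ^ K)"
proof -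
  obtain n :: nat where n: "lower_growth_order B < ereal (real n)"
    using fin less_PInf_Ex_of_nat by fastforce
  have "0 < ereal (real n)" using lower_growth_order_nonneg[of B] n by (rule le_less_trans)
  then have "0 < real n" by simp
  obtain K where K: "\<forall>\<^sub>F r in at_top. \<forall>(z0::complex) M. norm z0 = r \<longrightarrow>
     ((\<forall>z\<in>cball z0 1. norm (A z) \<le> M) \<longrightarrow> norm (B z0) \<le> r ^ K * (1 + M)) \<and>
     ((\<forall>z\<in>cball z0 1. norm (B z) \<le> M) \<longrightarrow> norm (A z0) \<le> exp (r ^ K) * (1 + M))"
    using ode_pointwise_bounds[OF f ode A B] by blast
  define m where "m = Suc (max K n)"
  have ev: "\<forall>\<^sub>F r in at_top. max_modulus (r + 1) B \<le> exp ((r + 1) powr real n) \<longrightarrow>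
                             (\<forall>z\<in>cball 0 r. norm (A z) \<le> exp (r ^ m))"
    using K eventually_ge_at_top[of "2 ^ n + 2"]
  proof eventually_elim
    case (elim r)
    have r: "r \<ge> 1" using elim(2) by (smt (verit) zero_le_power)
    show ?case
    proof
      assume MB: "max_modulus (r + 1) B \<le> exp ((r + 1) powr real n)"
      have "(r + 1) powr real n \<le> (2 * r) ^ n"
        using r power_mono[of "r + 1" "2 * r" n] by (simp add: powr_realpow del: power_mult_distrib)
      then have MB': "max_modulus (r + 1) B \<le> exp ((2 * r) ^ n)" using MB by (meson exp_le_cancel_iff order_trans)
      have *: "r ^ K + (1 + (2 * r) ^ n) \<le> r ^ m"
      proof -
        have "r ^ K + (1 + (2 * r) ^ n) \<le> r ^ max K n + (r ^ max K n + 2 ^ n * r ^ max K n)"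
          unfolding power_mult_distrib using r
          by (intro add_mono mult_left_mono power_increasing one_le_power) auto
        also have "\<dots> = (2 ^ n + 2) * r ^ max K n" by (simp add: algebra_simps)
        also have "\<dots> \<le> r * r ^ max K n" using elim(2) r by (intro mult_right_mono) auto
        finally show ?thesis by (simp add: m_def)
      qed
      have sph: "norm (A z0) \<le> exp (r ^ m)" if z0: "norm z0 = r" for z0 :: complex
      proof -
        have "norm (A z0) \<le> exp (r ^ K) * (1 + max_modulus (r + 1) B)"
          using elim(1) z0 norm_le_max_modulus_unit_disc[OF B(1) z0] by blast
        also have "\<dots> \<le> exp (r ^ K) * (exp ((2 * r) ^ n) + exp ((2 * r) ^ n))"
          using MB' r by (intro mult_left_mono add_mono) auto
        also have "\<dots> \<le> exp (r ^ K) * (exp 1 * exp ((2 * r) ^ n))"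
          using exp_ge_add_one_self[of 1] by (intro mult_left_mono) auto
        also have "\<dots> = exp (r ^ K + (1 + (2 * r) ^ n))" by (simp add: exp_add)
        also have "\<dots> \<le> exp (r ^ m)" using * by simp
        finally show ?thesis .
      qed
      then have "max_modulus r A \<le> exp (r ^ m)" using r by (intro max_modulus_le) auto
      then show "\<forall>z\<in>cball 0 r. norm (A z) \<le> exp (r ^ m)"
        using norm_le_max_modulus[OF A, of _ r] by fastforce
    qed
  qed
  from frequently_mp[OF ev lower_order_frequent_shift[OF B(1) n \<open>0 < real n\<close>]] show ?thesis by blast
qed


section \<open>Exponentials of polynomials times a factor of smaller growth\<close>

text \<open>
  Growth is assumed on a sequence of discs only, which is what a finite lower order provides. The
  quotient \<open>A / v\<close> is estimated on circles where \<open>v\<close> is not too small.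
\<close>
lemma Hadamard_factorization:
  assumes A: "A holomorphic_on UNIV" "A c \<noteq> 0" and "s > 0"
    and summ: "(\<lambda>a. of_int (zorder A a) * norm a powr (- s)) summable_on {a. a \<noteq> 0 \<and> A a = 0}"
    and freq: "\<exists>\<^sub>F r in at_top. \<forall>z\<in>cball 0 r. norm (A z) \<le> exp (r ^ K)"
  obtains v p where "v holomorphic_on UNIV" "\<And>z. A z = v z * exp (poly p z)"
    "\<And>t. t > s \<Longrightarrow> \<forall>\<^sub>F r in at_top. \<forall>z\<in>cball 0 r. norm (v z) \<le> exp (r powr t)"
proof -
  obtain v H where vH: "v holomorphic_on UNIV" "H holomorphic_on UNIV" "\<And>z. H z \<noteq> 0"
    "\<And>z. A z = v z * H z"
    "\<And>t. t > s \<Longrightarrow> \<forall>\<^sub>F r in at_top. \<forall>z\<in>cball 0 r. norm (v z) \<le> exp (r powr t)"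
    using zero_divisor_of_small_growth[OF A \<open>s > 0\<close> summ] by blast
  have "v c \<noteq> 0" using A(2) vH(4)[of c] by auto
  moreover have "finite_order v" by (rule finite_order_powr[OF vH(5)[of "s + 1"]]) simp
  ultimately obtain L where L: "\<forall>\<^sub>F r in at_top. \<forall>z0::complex. norm z0 = r \<longrightarrow> (\<exists>s\<in>{1/2..1}. \<forall>z. norm (z - z0) = s \<longrightarrow>
     (\<forall>G\<in>{v, v}. exp (- (r ^ L)) \<le> norm (G z) \<and> norm (deriv G z) \<le> r ^ L * norm (G z)))"
    using good_circles[of v v] vH(1) by blast
  have freq': "\<exists>\<^sub>F r in at_top. \<forall>z\<in>cball 0 (r + 1). norm (A z) \<le> exp ((r + 1) ^ K)"
    by (rule frequently_at_top_compose[OF freq, of "\<lambda>r. r - 1"]) (real_asymp | simp)+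
  define m where "m = Suc (max K L)"
  have "\<forall>\<^sub>F r in at_top. (\<forall>z\<in>cball 0 (r + 1). norm (A z) \<le> exp ((r + 1) ^ K)) \<longrightarrow>
          (\<forall>z. norm z = r \<longrightarrow> norm (H z) \<le> exp (r ^ m))"
    using L eventually_ge_at_top[of "2 ^ K + 1"]
  proof eventually_elim
    case (elim r)
    have r: "r \<ge> 1" using elim(2) by (smt (verit) zero_le_power)
    have "(r + 1) ^ K + r ^ L \<le> (2 * r) ^ K + r ^ L"
      using r by (intro add_right_mono power_mono) auto
    also have "\<dots> \<le> 2 ^ K * r ^ max K L + r ^ max K L"
      unfolding power_mult_distrib using r by (intro add_mono mult_left_mono power_increasing) auto
    also have "\<dots> = (2 ^ K + 1) * r ^ max K L" by (simp add: algebra_simps)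
    also have "\<dots> \<le> r * r ^ max K L" using elim(2) r by (intro mult_right_mono) auto
    finally have exponent: "(r + 1) ^ K + r ^ L \<le> r ^ m" by (simp add: m_def)
    show ?case
    proof (intro impI allI)
      fix z0 :: complex assume bd: "\<forall>z\<in>cball 0 (r + 1). norm (A z) \<le> exp ((r + 1) ^ K)" and z0: "norm z0 = r"
      obtain s where s: "s \<in> {1/2..1}" "\<And>z. norm (z - z0) = s \<Longrightarrow> exp (- (r ^ L)) \<le> norm (v z)"
        using elim(1) z0 by blast
      show "norm (H z0) \<le> exp (r ^ m)"
      proof (rule norm_centre_le[OF vH(2)])
        fix z assume z: "norm (z - z0) = s"
        have "norm z \<le> r + 1" using z s(1) z0 norm_triangle_ineq[of "z - z0" z0] by simp
        then have Az: "norm (A z) \<le> exp ((r + 1) ^ K)" using bd by simp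
        have "norm (H z) = exp (r ^ L) * (exp (- (r ^ L)) * norm (H z))"
          by (simp add: mult.assoc[symmetric] flip: exp_add)
        also have "\<dots> \<le> exp (r ^ L) * (norm (v z) * norm (H z))"
          using s(2)[OF z] by (intro mult_left_mono mult_right_mono) auto
        also have "\<dots> \<le> exp (r ^ L) * exp ((r + 1) ^ K)"
          using Az by (simp add: vH(4) norm_mult)
        also have "\<dots> = exp ((r + 1) ^ K + r ^ L)" by (simp add: exp_add)
        also have "\<dots> \<le> exp (r ^ m)" using exponent by simp
        finally show "norm (H z) \<le> exp (r ^ m)" .
      qed (use s in auto)
    qed
  qed
  from frequently_mp[OF this freq']
  obtain p where p: "\<And>z. H z = exp (poly p z)"
    using zero_free_of_frequent_growth[OF vH(2,3)] by blast
  show ?thesis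
  proof (rule that[OF vH(1) _ vH(5)])
    show "A z = v z * exp (poly p z)" for z using vH(4) p by simp
  qed
qed

lemma poly_terms_norm_le:
  fixes p :: "complex poly"
  assumes "r \<ge> 1" "norm z \<le> r" "I \<subseteq> {..degree p}" "\<And>i. i \<in> I \<Longrightarrow> i \<le> m"
  shows "norm (\<Sum>i\<in>I. coeff p i * z ^ i) \<le> (\<Sum>i\<le>degree p. norm (coeff p i)) * r ^ m"
proof -
  have "norm (\<Sum>i\<in>I. coeff p i * z ^ i) \<le> (\<Sum>i\<in>I. norm (coeff p i) * r ^ m)"
  proof (rule sum_norm_le)
    fix i assume i: "i \<in> I"
    have "norm z ^ i \<le> r ^ i" using assms by (intro power_mono) auto
    also have "\<dots> \<le> r ^ m" using assms i by (intro power_increasing) auto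
    finally show "norm (coeff p i * z ^ i) \<le> norm (coeff p i) * r ^ m"
      by (simp add: norm_mult norm_power mult_left_mono)
  qed
  also have "\<dots> = (\<Sum>i\<in>I. norm (coeff p i)) * r ^ m" by (simp add: sum_distrib_right)
  also have "\<dots> \<le> (\<Sum>i\<le>degree p. norm (coeff p i)) * r ^ m"
    using assms by (intro mult_right_mono sum_mono2) auto
  finally show ?thesis .
qed

lemma poly_norm_le:
  fixes p :: "complex poly"
  obtains C where "C \<ge> 0" "\<And>r z. r \<ge> 1 \<Longrightarrow> norm z \<le> r \<Longrightarrow> norm (poly p z) \<le> C * r ^ degree p"
proof
  show "(\<Sum>i\<le>degree p. norm (coeff p i)) \<ge> 0" by (simp add: sum_nonneg)
  show "norm (poly p z) \<le> (\<Sum>i\<le>degree p. norm (coeff p i)) * r ^ degree p"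
    if "r \<ge> 1" "norm z \<le> r" for r z
    unfolding poly_altdef by (rule poly_terms_norm_le[OF that]) auto
qed

lemma poly_minus_leading_term_norm_le:
  fixes p :: "complex poly"
  obtains C where "C \<ge> 0" "\<And>r z. r \<ge> 1 \<Longrightarrow> norm z \<le> r \<Longrightarrow>
       norm (poly p z - lead_coeff p * z ^ degree p) \<le> C * r ^ (degree p - 1)"
proof
  show "(\<Sum>i\<le>degree p. norm (coeff p i)) \<ge> 0" by (simp add: sum_nonneg)
  fix r :: real and z :: complex assume rz: "r \<ge> 1" "norm z \<le> r"
  have "{..degree p} = insert (degree p) {..<degree p}" by auto
  then have "poly p z - lead_coeff p * z ^ degree p = (\<Sum>i\<in>{..<degree p}. coeff p i * z ^ i)"
    by (simp add: poly_altdef)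
  also have "norm \<dots> \<le> (\<Sum>i\<le>degree p. norm (coeff p i)) * r ^ (degree p - 1)"
    by (rule poly_terms_norm_le[OF rz]) auto
  finally show "norm (poly p z - lead_coeff p * z ^ degree p)
      \<le> (\<Sum>i\<le>degree p. norm (coeff p i)) * r ^ (degree p - 1)" .
qed

lemma growth_order_le_degree:
  assumes A: "A holomorphic_on UNIV" "\<And>z. A z = v z * exp (poly p z)"
    and v: "\<forall>\<^sub>F r in at_top. \<forall>z\<in>cball 0 r. norm (v z) \<le> exp (r powr s)"
    and t: "t > s" "t > degree p" "s > 0"
  shows "growth_order A \<le> ereal t"
proof (rule growth_order_le[OF A(1)])
  show "0 \<le> t" using t by simp
  obtain C where C: "C \<ge> 0" "\<And>r z. r \<ge> 1 \<Longrightarrow> norm z \<le> r \<Longrightarrow> norm (poly p z) \<le> C * r ^ degree p"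
    using poly_norm_le[of p] by metis
  have "\<forall>\<^sub>F r in at_top. r powr s + C * r powr real (degree p) \<le> r powr t"
  proof (cases "C = 0")
    case True
    have "\<forall>\<^sub>F r in at_top. r powr s \<le> r powr t" using t by real_asymp
    then show ?thesis using True by simp
  next
    case False
    define n where "n = real (degree p)"
    have "C > 0" "t > s" "t > n" "s > 0" "n \<ge> 0" using False C t by (auto simp: n_def)
    then have "\<forall>\<^sub>F r in at_top. r powr s \<le> r powr t / 2" "\<forall>\<^sub>F r in at_top. C * r powr n \<le> r powr t / 2"
      by real_asymp+
    then show ?thesis unfolding n_def[symmetric] by eventually_elim simp
  qed
  then show "\<forall>\<^sub>F r in at_top. max_modulus r A \<le> exp (r powr t)"
    using v eventually_ge_at_top[of 1]
  proof eventually_elim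
    case (elim r)
    show ?case
    proof (rule max_modulus_le)
      fix z :: complex assume z: "norm z = r"
      have "norm (A z) \<le> exp (r powr s) * exp (C * r ^ degree p)"
        unfolding A(2) norm_mult
      proof (rule mult_mono)
        show "norm (exp (poly p z)) \<le> exp (C * r ^ degree p)"
          using C(2)[OF elim(3), of z] z abs_Re_le_cmod[of "poly p z"] by simp
      qed (use elim z in auto)
      also have "\<dots> \<le> exp (r powr t)"
        using elim by (simp add: powr_realpow flip: exp_add)
      finally show "norm (A z) \<le> exp (r powr t)" .
    qed (use elim in simp)
  qed
qed

lemma norm_power_diff_le:
  fixes z w :: complex
  assumes "norm z \<le> r" "norm w \<le> r"
  shows "norm (z ^ n - w ^ n) \<le> norm (z - w) * (real n * r ^ (n - 1))"
proof -
  have "r \<ge> 0" using assms(1) norm_ge_zero order_trans by blast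
  have "norm (\<Sum>i<n. w ^ (n - Suc i) * z ^ i) \<le> (\<Sum>i<n. r ^ (n - 1))"
  proof (rule sum_norm_le)
    fix i assume i: "i \<in> {..<n}"
    have "norm (w ^ (n - Suc i) * z ^ i) \<le> r ^ (n - Suc i) * r ^ i"
      unfolding norm_mult norm_power using assms \<open>r \<ge> 0\<close> by (intro mult_mono power_mono) auto
    also have "\<dots> = r ^ (n - 1)" using i by (simp flip: power_add)
    finally show "norm (w ^ (n - Suc i) * z ^ i) \<le> r ^ (n - 1)" .
  qed
  then have "norm (\<Sum>i<n. w ^ (n - Suc i) * z ^ i) \<le> real n * r ^ (n - 1)" by simp
  then show ?thesis
    unfolding power_diff_sumr2 norm_mult by (intro mult_left_mono) auto
qed

text \<open>
  Replacing \<open>z0\<close> by a point at distance at most \<open>1\<close>, and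
  \<open>p\<close> by its leading term, changes the exponent by \<open>O(r ^ (n - 1))\<close>
  only. The unit disc is included because the bounds from the equation use the values of
  \<open>A\<close> there.
\<close>
lemma small_in_decay_sectors:
  fixes p :: "complex poly"
  defines "n \<equiv> degree p" and "c \<equiv> lead_coeff p"
  assumes "0 < s" "s < real n" "\<eta> > 0"
    and v: "\<forall>\<^sub>F r in at_top. \<forall>z\<in>cball 0 r. norm (v z) \<le> exp (r powr s)"
  shows "\<forall>\<^sub>F r in at_top. \<forall>z0::complex. norm z0 = r \<longrightarrow> Re (c * z0 ^ n) \<le> - \<eta> * r ^ n \<longrightarrow>
           (\<forall>z\<in>cball z0 1. norm (v z * exp (poly p z)) \<le> 1)"
proof -
  obtain C where C: "C \<ge> 0" "\<And>r z. r \<ge> 1 \<Longrightarrow> norm z \<le> r \<Longrightarrow>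
       norm (poly p z - c * z ^ n) \<le> C * r ^ (n - 1)"
    using poly_minus_leading_term_norm_le[of p] unfolding n_def c_def by metis
  have n: "n \<ge> 1" using assms(3,4) by (cases n) auto
  define D where "D = (C + norm c * real n) * 2 ^ (n - 1) + 1"
  have D: "D > 0" using C(1) by (simp add: D_def add_nonneg_pos)
  have v': "\<forall>\<^sub>F r in at_top. \<forall>z\<in>cball 0 (r + 1). norm (v z) \<le> exp ((r + 1) powr s)"
    by (rule eventually_compose_filterlim[OF v]) real_asymp
  define N where "N = real n"
  have "s < N" using assms by (simp add: N_def)
  then have a1: "\<forall>\<^sub>F r in at_top. (r + 1) powr s \<le> \<eta> / 2 * r powr N"
    using \<open>0 < s\<close> \<open>\<eta> > 0\<close> by real_asymp
  show ?thesis
    using v' a1 eventually_ge_at_top[of 1] eventually_ge_at_top[of "2 * D / \<eta>"]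
  proof eventually_elim
    case (elim r)
    have r: "r \<ge> 1" by fact
    have "D * r ^ (n - 1) \<le> \<eta> / 2 * r * r ^ (n - 1)"
      using elim(4) r \<open>\<eta> > 0\<close> by (intro mult_right_mono) (auto simp: field_simps)
    also have "\<dots> = \<eta> / 2 * r ^ n" using n by (cases n) auto
    finally have Dr: "D * r ^ (n - 1) \<le> \<eta> / 2 * r ^ n" .
    have a1': "(r + 1) powr s \<le> \<eta> / 2 * r ^ n" using elim(2) r by (simp add: N_def powr_realpow)
    show ?case
    proof (intro allI impI ballI)
      fix z0 z :: complex assume z0: "norm z0 = r" "Re (c * z0 ^ n) \<le> - \<eta> * r ^ n" and z: "z \<in> cball z0 1"
      have zz0: "norm (z - z0) \<le> 1" using z by (simp add: dist_norm norm_minus_commute)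
      then have nz: "norm z \<le> r + 1" using norm_triangle_ineq[of "z - z0" z0] z0 by simp
      have "norm (poly p z - c * z0 ^ n) \<le> norm (poly p z - c * z ^ n) + norm (c * (z ^ n - z0 ^ n))"
        using norm_triangle_ineq[of "poly p z - c * z ^ n" "c * (z ^ n - z0 ^ n)"] by (simp add: algebra_simps)
      also have "\<dots> \<le> C * (2 * r) ^ (n - 1) + norm c * (1 * (real n * (2 * r) ^ (n - 1)))"
      proof (rule add_mono)
        show "norm (poly p z - c * z ^ n) \<le> C * (2 * r) ^ (n - 1)" using r nz by (intro C(2)) auto
        have "norm (z ^ n - z0 ^ n) \<le> norm (z - z0) * (real n * (2 * r) ^ (n - 1))"
          using r nz z0 by (intro norm_power_diff_le) auto
        also have "\<dots> \<le> 1 * (real n * (2 * r) ^ (n - 1))" using zz0 r by (intro mult_right_mono) auto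
        finally show "norm (c * (z ^ n - z0 ^ n)) \<le> norm c * (1 * (real n * (2 * r) ^ (n - 1)))"
          unfolding norm_mult by (intro mult_left_mono) auto
      qed
      also have "\<dots> \<le> D * r ^ (n - 1)" using r by (simp add: D_def power_mult_distrib algebra_simps)
      also have "\<dots> \<le> \<eta> / 2 * r ^ n" by (rule Dr)
      finally have "Re (poly p z) \<le> Re (c * z0 ^ n) + \<eta> / 2 * r ^ n"
        using abs_Re_le_cmod[of "poly p z - c * z0 ^ n"] by simp
      then have Re: "Re (poly p z) \<le> - (\<eta> / 2 * r ^ n)" using z0(2) by simp
      have "norm (v z * exp (poly p z)) \<le> exp ((r + 1) powr s) * exp (Re (poly p z))"
        using elim(1) nz by (simp add: norm_mult mult_right_mono)
      also have "\<dots> = exp ((r + 1) powr s + Re (poly p z))" by (simp add: exp_add)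
      also have "\<dots> \<le> 1" using a1' Re by simp
      finally show "norm (v z * exp (poly p z)) \<le> 1" .
    qed
  qed
qed


section \<open>Sectors and the theorem\<close>

lemma frequently_exp_scale:
  assumes "\<exists>\<^sub>F r in at_top. P (r::real)"
  shows "\<exists>\<^sub>F x in at_top. P (exp x)"
  by (rule frequently_at_top_compose[OF assms ln_at_top])
     (use eventually_gt_at_top[of 0] in \<open>auto elim: eventually_mono\<close>)

lemma cos_minus_2pi_int: "cos (x - 2 * pi * of_int j) = cos (x::real)"
  by (simp add: cos_diff cos_int_2pin sin_int_2pin)

text \<open>
  In the coordinate \<open>\<zeta> = ln z\<close>, \<open>Re (c z ^ n)\<close> has the sign of
  \<open>cos (n Im \<zeta> + \<gamma>)\<close>, where \<open>\<gamma>\<close> is the argument of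
  \<open>c\<close>. The bound holds where this cosine is at most \<open>- sin \<sigma>\<close>;
  the remaining \<open>\<zeta>\<close> lie in horizontal strips of half-width \<open>\<beta> = (pi
  / 2 + \<sigma>) / n\<close>, and \<open>\<sigma>\<close> is so small that the Phragmen-Lindelof
  principle applies with an exponent \<open>d'\<close> strictly between \<open>d\<close> and
  \<open>n\<close>.
\<close>
lemma polynomial_of_sectorial_bounds:
  fixes B :: "complex \<Rightarrow> complex"
  assumes B: "B holomorphic_on UNIV" and n: "n \<ge> 1" and "c \<noteq> 0" and d: "0 < d" "d < real n"
    and decay: "\<And>\<eta>. \<eta> > 0 \<Longrightarrow> \<forall>\<^sub>F r in at_top. \<forall>z. norm z = r \<longrightarrow> Re (c * z ^ n) \<le> - \<eta> * r ^ n \<longrightarrow>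
                   norm (B z) \<le> r ^ K"
    and freq: "\<exists>\<^sub>F r in at_top. max_modulus r B \<le> exp (r powr d)"
  shows "\<exists>p. B = poly p"
proof -
  define d' where "d' = (d + n) / 2"
  have d': "0 < d'" "d < d'" "d' < n" using d by (auto simp: d'_def)
  \<comment> \<open>the second bound makes \<open>d' * \<beta> < pi / 2\<close>, the first keeps \<open>pi / 2 + \<sigma>\<close> below \<open>pi\<close>\<close>
  define \<sigma> where "\<sigma> = min (pi / 4) (pi / 4 * (n / d' - 1))"
  have "n / d' > 1" using d' by simp
  then have \<sigma>: "0 < \<sigma>" "\<sigma> \<le> pi / 4" "\<sigma> \<le> pi / 4 * (n / d' - 1)"
    unfolding \<sigma>_def by (auto simp: min_def)
  define \<beta> where "\<beta> = (pi / 2 + \<sigma>) / n"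
  have n\<beta>: "n * \<beta> = pi / 2 + \<sigma>" using n by (simp add: \<beta>_def)
  have "\<beta> > 0" using n \<sigma>(1) by (auto simp: \<beta>_def intro!: divide_pos_pos add_pos_pos)
  have "\<sigma> < pi / 2 * (n / d' - 1)"
  proof -
    have "pi / 4 * (n / d' - 1) < pi / 2 * (n / d' - 1)"
      using \<open>n / d' > 1\<close> by (intro mult_strict_right_mono) auto
    then show ?thesis using \<sigma>(3) by linarith
  qed
  then have "pi / 2 + \<sigma> < pi / 2 * (n / d')" by (simp add: algebra_simps)
  then have "d' * (n * \<beta>) < d' * (pi / 2 * (n / d'))"
    unfolding n\<beta> using d'(1) by (rule mult_strict_left_mono)
  also have "d' * (pi / 2 * (n / d')) = n * (pi / 2)" using d'(1) by simp
  finally have "n * (d' * \<beta>) < n * (pi / 2)" by (simp only: mult.left_commute)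
  then have d'\<beta>: "d' * \<beta> < pi / 2" using n by simp
  define \<eta> where "\<eta> = norm c * sin \<sigma>"
  have "sin \<sigma> > 0" using \<sigma> pi_gt_zero by (intro sin_gt_zero) linarith+
  then have "\<eta> > 0" using \<open>c \<noteq> 0\<close> by (simp add: \<eta>_def)
  from decay[OF this] obtain R1 where R1: "\<And>z. norm z \<ge> R1 \<Longrightarrow>
      Re (c * z ^ n) \<le> - \<eta> * norm z ^ n \<Longrightarrow> norm (B z) \<le> norm z ^ K"
    unfolding eventually_at_top_linorder by blast
  define R where "R = max 1 R1"
  have R: "R \<ge> 1" "R \<ge> R1" by (auto simp: R_def)
  define \<gamma> where "\<gamma> = Im (Ln c)"
  have Re_c: "Re (c * exp \<zeta> ^ n) = norm c * exp (Re \<zeta>) ^ n * cos (n * Im \<zeta> + \<gamma>)" for \<zeta>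
  proof -
    have "c * exp \<zeta> ^ n = exp (Ln c + of_nat n * \<zeta>)"
      using \<open>c \<noteq> 0\<close> by (simp add: exp_add exp_of_nat_mult)
    then have "Re (c * exp \<zeta> ^ n) = exp (ln (norm c) + n * Re \<zeta>) * cos (n * Im \<zeta> + \<gamma>)"
      using \<open>c \<noteq> 0\<close> by (simp only: Re_exp) (simp add: \<gamma>_def add.commute)
    also have "exp (ln (norm c) + n * Re \<zeta>) = norm c * exp (Re \<zeta>) ^ n"
      using \<open>c \<noteq> 0\<close> by (simp add: exp_add exp_of_nat_mult)
    finally show ?thesis .
  qed
  have in_decay: "norm (B (exp \<zeta>)) \<le> exp (K * Re \<zeta>)"
    if "Re \<zeta> \<ge> ln R" "cos (n * Im \<zeta> + \<gamma>) \<le> - sin \<sigma>" for \<zeta>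
  proof -
    have "exp (Re \<zeta>) \<ge> R" using that(1) R by (metis exp_le_cancel_iff exp_ln less_le_trans zero_less_one)
    moreover have "Re (c * exp \<zeta> ^ n) \<le> - \<eta> * exp (Re \<zeta>) ^ n"
      using mult_left_mono[OF that(2), of "norm c * exp (Re \<zeta>) ^ n"] unfolding Re_c \<eta>_def by (simp add: mult_ac)
    ultimately have "norm (B (exp \<zeta>)) \<le> exp (Re \<zeta>) ^ K" using R1[of "exp \<zeta>"] R by simp
    then show ?thesis by (simp add: exp_of_nat_mult)
  qed
  define M where "M = max 1 (max_modulus R B)"
  have M: "M \<ge> 1" by (simp add: M_def)
  have strip: "norm (B (exp \<zeta>)) \<le> M * exp (K * Re \<zeta>)" if \<zeta>: "Re \<zeta> \<ge> ln R" for \<zeta>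
  proof -
    \<comment> \<open>\<open>j\<close> selects the nearest direction in which \<open>Re (c z ^ n)\<close> is maximal, and \<open>\<psi>\<close> is the phase relative to it\<close>
    define j where "j = round ((n * Im \<zeta> + \<gamma>) / (2 * pi))"
    define \<psi> where "\<psi> = n * Im \<zeta> + \<gamma> - 2 * pi * of_int j"
    have "\<bar>\<psi>\<bar> \<le> pi"
    proof -
      have "\<bar>of_int j - (n * Im \<zeta> + \<gamma>) / (2 * pi)\<bar> \<le> 1 / 2"
        unfolding j_def by (rule of_int_round_abs_le)
      then have "2 * pi * \<bar>of_int j - (n * Im \<zeta> + \<gamma>) / (2 * pi)\<bar> \<le> 2 * pi * (1 / 2)"
        by (intro mult_left_mono) auto
      also have "2 * pi * \<bar>of_int j - (n * Im \<zeta> + \<gamma>) / (2 * pi)\<bar> = \<bar>2 * pi * (of_int j - (n * Im \<zeta> + \<gamma>) / (2 * pi))\<bar>"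
        by (simp add: abs_mult)
      also have "2 * pi * (of_int j - (n * Im \<zeta> + \<gamma>) / (2 * pi)) = - \<psi>"
        by (simp add: \<psi>_def right_diff_distrib)
      finally show ?thesis by simp
    qed
    show ?thesis
    proof (cases "\<bar>\<psi>\<bar> \<ge> pi / 2 + \<sigma>")
      case True
      have "cos (n * Im \<zeta> + \<gamma>) = cos \<bar>\<psi>\<bar>" by (simp add: \<psi>_def cos_minus_2pi_int)
      also have "\<dots> \<le> cos (pi / 2 + \<sigma>)"
        using True \<open>\<bar>\<psi>\<bar> \<le> pi\<close> \<sigma> by (intro cos_monotone_0_pi_le) auto
      also have "\<dots> = - sin \<sigma>" by (simp add: cos_add)
      finally have "norm (B (exp \<zeta>)) \<le> 1 * exp (K * Re \<zeta>)" using in_decay[OF \<zeta>] by simp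
      also have "\<dots> \<le> M * exp (K * Re \<zeta>)" using M by (intro mult_right_mono) auto
      finally show ?thesis .
    next
      case False
      define y where "y = (2 * pi * of_int j - \<gamma>) / n"
      have ny: "n * y = 2 * pi * of_int j - \<gamma>" using n by (simp add: y_def)
      define F where "F w = B (exp (w + \<i> * y))" for w
      have "norm (F (\<zeta> - \<i> * y)) \<le> M * exp (K * Re (\<zeta> - \<i> * y))"
      proof (rule Phragmen_Lindelof_half_strip[where \<beta> = \<beta> and d = d and d' = d' and ?x0.0 = "ln R"])
        have "(B \<circ> (\<lambda>w. exp (w + \<i> * y))) holomorphic_on UNIV"
          using B by (intro holomorphic_on_compose_gen[of _ _ B UNIV] holomorphic_intros) auto
        then show "F holomorphic_on UNIV" by (simp add: F_def[abs_def] o_def)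
        show "norm (F w) \<le> M * exp (K * Re w)" if w: "ln R \<le> Re w" "\<bar>Im w\<bar> = \<beta>" for w
        proof -
          have "n * Im (w + \<i> * y) + \<gamma> = n * Im w + 2 * pi * of_int j"
            using ny by (simp add: algebra_simps)
          then have "cos (n * Im (w + \<i> * y) + \<gamma>) = cos (n * Im w)"
            using cos_minus_2pi_int[of "n * Im (w + \<i> * y) + \<gamma>" j] by simp
          also have "\<dots> = cos \<bar>n * Im w\<bar>" by simp
          also have "\<bar>n * Im w\<bar> = pi / 2 + \<sigma>" using w(2) n\<beta> by (simp add: abs_mult)
          also have "cos (pi / 2 + \<sigma>) = - sin \<sigma>" by (simp add: cos_add)
          finally have "norm (F w) \<le> 1 * exp (K * Re w)"
            using in_decay[of "w + \<i> * y"] w(1) by (simp add: F_def)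
          also have "\<dots> \<le> M * exp (K * Re w)" using M by (intro mult_right_mono) auto
          finally show ?thesis .
        qed
        show "norm (F w) \<le> M * exp (K * Re w)" if w: "Re w = ln R" "\<bar>Im w\<bar> \<le> \<beta>" for w
        proof -
          have "norm (exp (w + \<i> * y)) = R" using w(1) R by simp
          then have "norm (F w) \<le> M * 1"
            using norm_le_max_modulus[OF B, of "exp (w + \<i> * y)" R] by (simp add: F_def M_def)
          also have "\<dots> \<le> M * exp (K * Re w)" using w(1) R M by (intro mult_left_mono) auto
          finally show ?thesis .
        qed
        show "\<exists>\<^sub>F x in at_top. \<forall>w. Re w = x \<longrightarrow> \<bar>Im w\<bar> \<le> \<beta> \<longrightarrow> norm (F w) \<le> exp (exp (d * x))"
        proof (rule frequently_elim1[OF frequently_exp_scale[OF freq]])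
          fix x assume x: "max_modulus (exp x) B \<le> exp (exp x powr d)"
          have "norm (F w) \<le> exp (exp (d * x))" if "Re w = x" for w
          proof -
            have "norm (F w) \<le> max_modulus (exp x) B"
              unfolding F_def using that by (intro norm_le_max_modulus[OF B]) simp
            also have "\<dots> \<le> exp (exp (d * x))" using x by (simp add: powr_def)
            finally show ?thesis .
          qed
          then show "\<forall>w. Re w = x \<longrightarrow> \<bar>Im w\<bar> \<le> \<beta> \<longrightarrow> norm (F w) \<le> exp (exp (d * x))" by blast
        qed
        have "n * \<bar>Im (\<zeta> - \<i> * y)\<bar> = \<bar>\<psi>\<bar>"
        proof -
          have "\<psi> = n * Im (\<zeta> - \<i> * y)" using ny by (simp add: \<psi>_def algebra_simps)
          then show ?thesis by (simp add: abs_mult)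
        qed
        also have "\<dots> \<le> n * \<beta>" using False n\<beta> by simp
        finally show "\<bar>Im (\<zeta> - \<i> * y)\<bar> \<le> \<beta>" using n by simp
      qed (use \<open>\<beta> > 0\<close> d' d'\<beta> M R \<zeta> in auto)
      then show ?thesis by (simp add: F_def)
    qed
  qed
  have poly_bound: "norm (B z) \<le> M * norm z ^ K" if "norm z \<ge> R" for z
  proof -
    have z: "z \<noteq> 0" using that R by auto
    then have "norm (B (exp (Ln z))) \<le> M * exp (K * Re (Ln z))"
      using that R by (intro strip) simp
    then show ?thesis using z by (simp add: exp_of_nat_mult)
  qed
  obtain p where "B = poly p"
  proof (rule polynomial_of_frequent_growth[OF B])
    show "\<exists>r\<ge>R0. \<forall>z. norm z = r \<longrightarrow> norm (B z) \<le> M * r ^ K" for R0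
      by (intro exI[of _ "max R R0"]) (metis max.cobounded1 max.cobounded2 poly_bound)
  qed
  then show ?thesis by blast
qed

lemma transcendental_entire_nonzero:
  assumes "transcendental_entire A"
  obtains c where "A c \<noteq> 0"
  using assms unfolding transcendental_entire_def by (metis ext poly_0)

theorem corollary1:
  fixes A B f :: "complex \<Rightarrow> complex"
  assumes "transcendental_entire A"
    and "transcendental_entire B"
    and "zeros_exponent A < growth_order A"
    and "lower_growth_order A \<noteq> lower_growth_order B"
    and "f holomorphic_on UNIV"
    and "\<And>z. deriv (deriv f) z + A z * deriv f z + B z * f z = 0"
    and "\<exists>z. f z \<noteq> 0"
  shows "growth_order f = \<infinity>"
proof (rule ccontr)
  assume "growth_order f \<noteq> \<infinity>"
  then have fin: "finite_order f"
    using finite_order_of_growth_order[OF _ assms(5)] by (simp add: less_top top_ereal_def)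
  have A: "A holomorphic_on UNIV" and B: "B holomorphic_on UNIV" and B_trans: "\<not> (\<exists>p. B = poly p)"
    using assms(1,2) by (auto simp: transcendental_entire_def)
  obtain a where a: "A a \<noteq> 0" using transcendental_entire_nonzero[OF assms(1)] .
  obtain b where b: "B b \<noteq> 0" using transcendental_entire_nonzero[OF assms(2)] .
  obtain z1 where z1: "f z1 \<noteq> 0" using assms(7) by blast
  note ode = assms(6)
  have "lower_growth_order B \<le> lower_growth_order A"
    by (rule ode_lower_order_le[OF assms(5) z1 fin ode A B b])
  then have less: "lower_growth_order B < lower_growth_order A" using assms(4) by simp
  then have "lower_growth_order B < \<infinity>" by (rule less_le_trans) simp
  then obtain K where K: "\<exists>\<^sub>F r in at_top. \<forall>z\<in>cball 0 r. norm (A z) \<le> exp (r ^ K)"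
    using ode_frequent_growth[OF assms(5) z1 fin ode A B b] by blast
  obtain s where s: "s > 0" "ereal s < growth_order A"
    "(\<lambda>w. of_int (zorder A w) * norm w powr (- s)) summable_on {w. w \<noteq> 0 \<and> A w = 0}"
    using assms(3) unfolding zeros_exponent_def Inf_less_iff by auto
  obtain v p where vp: "v holomorphic_on UNIV" "\<And>z. A z = v z * exp (poly p z)"
    "\<And>t. t > s \<Longrightarrow> \<forall>\<^sub>F r in at_top. \<forall>z\<in>cball 0 r. norm (v z) \<le> exp (r powr t)"
    by (rule Hadamard_factorization[OF A a s(1,3) K]) (rule that; assumption)
  define n where "n = degree p"
  have order_le: "growth_order A \<le> ereal t" if "t > s" "t > n" for t
    by (rule growth_order_le_degree[OF A vp(2) vp(3)[of "(s + t) / 2"]])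
       (use that s(1) in \<open>auto simp: n_def\<close>)
  \<comment> \<open>otherwise \<open>v\<close> would dominate and the order of \<open>A\<close> would be at most \<open>s\<close>\<close>
  have sn: "s < n"
  proof (rule ccontr)
    assume "\<not> s < n"
    obtain t where "ereal s < ereal t" "ereal t < growth_order A" using ereal_dense2[OF s(2)] by blast
    then show False using order_le[of t] \<open>\<not> s < n\<close> by simp
  qed
  have "growth_order A \<le> ereal n"
  proof (rule ccontr)
    assume "\<not> ?thesis"
    then have "ereal n < growth_order A" by (simp only: not_le)
    then obtain t where "ereal n < ereal t" "ereal t < growth_order A" using ereal_dense2 by blast
    then show False using order_le[of t] sn by simp
  qed
  then have "lower_growth_order B < ereal n"
    using less lower_growth_order_le_growth_order[of A] by (meson less_le_trans order_trans)
  then obtain d where d: "lower_growth_order B < ereal d" "ereal d < ereal n"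
    using ereal_dense2 by blast
  have "0 < ereal d" using lower_growth_order_nonneg[of B] d(1) by (rule le_less_trans)
  then have "d > 0" by simp
  have n: "n \<ge> 1" using sn s(1) by (cases n) auto
  have lead: "lead_coeff p \<noteq> 0" using n by (auto simp: n_def)
  obtain L where L: "\<forall>\<^sub>F r in at_top. \<forall>(z0::complex) M. norm z0 = r \<longrightarrow>
     ((\<forall>z\<in>cball z0 1. norm (A z) \<le> M) \<longrightarrow> norm (B z0) \<le> r ^ L * (1 + M)) \<and>
     ((\<forall>z\<in>cball z0 1. norm (B z) \<le> M) \<longrightarrow> norm (A z0) \<le> exp (r ^ L) * (1 + M))"
    using ode_pointwise_bounds[OF assms(5) z1 fin ode A B b] by blast
  have "\<exists>p. B = poly p"
  proof (rule polynomial_of_sectorial_bounds[OF B n lead \<open>d > 0\<close>])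
    show "d < real n" using d(2) by simp
    show "\<exists>\<^sub>F r in at_top. max_modulus r B \<le> exp (r powr d)"
      using \<open>d > 0\<close> by (intro lower_growth_order_lessD[OF B d(1)]) simp
    fix \<eta> :: real assume "\<eta> > 0"
    define s' where "s' = (s + n) / 2"
    have s': "s < s'" "s' < n" "0 < s'" using sn s(1) by (auto simp: s'_def)
    have "\<forall>\<^sub>F r in at_top. \<forall>z0. norm z0 = r \<longrightarrow> Re (lead_coeff p * z0 ^ n) \<le> - \<eta> * r ^ n \<longrightarrow>
           (\<forall>z\<in>cball z0 1. norm (v z * exp (poly p z)) \<le> 1)"
      unfolding n_def
      by (rule small_in_decay_sectors[OF _ _ \<open>\<eta> > 0\<close> vp(3)[OF s'(1)]]) (use s' in \<open>auto simp: n_def\<close>)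
    then show "\<forall>\<^sub>F r in at_top. \<forall>z. norm z = r \<longrightarrow> Re (lead_coeff p * z ^ n) \<le> - \<eta> * r ^ n \<longrightarrow>
        norm (B z) \<le> r ^ (L + 1)"
      using L eventually_ge_at_top[of 2]
    proof eventually_elim
      case (elim r)
      have "norm (B z) \<le> r ^ (L + 1)"
        if "norm z = r" "Re (lead_coeff p * z ^ n) \<le> - \<eta> * r ^ n" for z
      proof -
        have "\<forall>w\<in>cball z 1. norm (A w) \<le> 1" using elim(1) that vp(2) by simp
        then have "norm (B z) \<le> r ^ L * (1 + 1)" using elim(2) that(1) by blast
        also have "\<dots> \<le> r ^ L * r" using elim(3) by (intro mult_left_mono) auto
        finally show ?thesis by (simp add: mult.commute)
      qed
      then show ?case by blast
    qed
  qed
  then show False using B_trans by blast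
qed

end
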